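(* For every $(A,B,C,D)\in\mathbb{C}^4$ there is a point $p\in\mathcal{J}_{A,B,C,D}$ such that $\overline{\mathcal{G}(p)}=\mathcal{J}_{A,B,C,D}$, where $\mathcal{G}(p)=\{\gamma(p):\gamma\in\mathcal{G}_{A,B,C,D}\}$; i.e., there is a dense orbit of $\mathcal{G}_{A,B,C,D}$ in the Julia set $\mathcal{J}_{A,B,C,D}$.
   Context: For $(A,B,C,D)\in\mathbb{C}^4$ let $S_{A,B,C,D}=\{(x,y,z)\in\mathbb{C}^3: x^2+y^2+z^2+xyz=Ax+By+Cz+D\}$. The involutions $s_x(x,y,z)=(-x-yz+A,\,y,\,z)$, $s_y(x,y,z)=(x,\,-y-xz+B,\,z)$, $s_z(x,y,z)=(x,\,y,\,-z-xy+C)$ preserve $S_{A,B,C,D}$. Let $\mathcal{G}_{A,B,C,D}=\langle g_x,g_y,g_z\rangle$ be the group of automorphisms of $S_{A,B,C,D}$ generated by $g_x=s_z\circ s_y$, $g_y=s_x\circ s_z$, $g_z=s_y\circ s_x$. A sequence of maps $f_i$ converges to infinity on an open set $U\subset S_{A,B,C,D}$ if for every compact $\overline V\subset U$ and every compact $K\subset S_{A,B,C,D}$ only finitely many $i$ satisfy $f_i(\overline V)\cap K\neq\emptyset$. The group $\mathcal{G}_{A,B,C,D}$ forms a normal family on $U$ if every sequence of its elements has a subsequence that, on $U$, either converges uniformly on compact subsets or converges to infinity. The Fatou set $\mathcal{F}_{A,B,C,D}$ is the set of $p\in S_{A,B,C,D}$ having an open neighborhood on which $\mathcal{G}_{A,B,C,D}$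 forms a normal family; the Julia set is $\mathcal{J}_{A,B,C,D}=S_{A,B,C,D}\setminus\mathcal{F}_{A,B,C,D}$. *)

theory Defs
  imports "HOL-Analysis.Analysis" "HOL-Algebra.Bij" "HOL-Algebra.Generated_Groups"
begin

definition surf :: "complex \<Rightarrow> complex \<Rightarrow> complex \<Rightarrow> complex \<Rightarrow> (complex \<times> complex \<times> complex) set" where
  "surf A B C D = {(x, y, z). x^2 + y^2 + z^2 + x * y * z = A * x + B * y + C * z + D}"

definition s_x :: "complex \<Rightarrow> complex \<times> complex \<times> complex \<Rightarrow> complex \<times> complex \<times> complex" where
  "s_x A = (\<lambda>(x, y, z). (- x - y * z + A, y, z))"

definition s_y :: "complex \<Rightarrow> complex \<times> complex \<times> complex \<Rightarrow> complex \<times> complex \<times> complex" where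
  "s_y B = (\<lambda>(x, y, z). (x, - y - x * z + B, z))"

definition s_z :: "complex \<Rightarrow> complex \<times> complex \<times> complex \<Rightarrow> complex \<times> complex \<times> complex" where
  "s_z C = (\<lambda>(x, y, z). (x, y, - z - x * y + C))"

definition g_x :: "complex \<Rightarrow> complex \<Rightarrow> complex \<Rightarrow> complex \<times> complex \<times> complex \<Rightarrow> complex \<times> complex \<times> complex" where
  "g_x A B C = s_z C \<circ> s_y B"

definition g_y :: "complex \<Rightarrow> complex \<Rightarrow> complex \<Rightarrow> complex \<times> complex \<times> complex \<Rightarrow> complex \<times> complex \<times> complex" where
  "g_y A B C = s_x A \<circ> s_z C"

definition g_z :: "complex \<Rightarrow> complex \<Rightarrow> complex \<Rightarrow> complex \<times> complex \<times> complex \<Rightarrow> complex \<times> complex \<times> complex" where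
  "g_z A B C = s_y B \<circ> s_x A"

text \<open>The maps are polynomial maps of the ambient space, restricted to the surface so that
  they are elements of the group of bijections of the surface, whose elements are
  extensional functions.\<close>

definition grp :: "complex \<Rightarrow> complex \<Rightarrow> complex \<Rightarrow> complex \<Rightarrow>
    (complex \<times> complex \<times> complex \<Rightarrow> complex \<times> complex \<times> complex) set" where
  "grp A B C D = generate (BijGroup (surf A B C D))
     {restrict (g_x A B C) (surf A B C D),
      restrict (g_y A B C) (surf A B C D),
      restrict (g_z A B C) (surf A B C D)}"

lemma s_x_surf: "p \<in> surf A B C D \<Longrightarrow> s_x A p \<in> surf A B C D"
  by (auto simp: surf_def s_x_def algebra_simps power2_eq_square)

lemma s_y_surf: "p \<in> surf A B C D \<Longrightarrow> s_y B p \<in> surf A B C D"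
  by (auto simp: surf_def s_y_def algebra_simps power2_eq_square)

lemma s_z_surf: "p \<in> surf A B C D \<Longrightarrow> s_z C p \<in> surf A B C D"
  by (auto simp: surf_def s_z_def algebra_simps power2_eq_square)

lemma s_invol [simp]: "s_x A (s_x A p) = p" "s_y B (s_y B p) = p" "s_z C (s_z C p) = p"
  by (auto simp: s_x_def s_y_def s_z_def split: prod.splits)

lemma restrict_comp_Bij:
  assumes "\<And>p. p \<in> S \<Longrightarrow> f p \<in> S" "\<And>p. p \<in> S \<Longrightarrow> g p \<in> S"
    and "\<And>p. f (f p) = p" "\<And>p. g (g p) = p"
  shows "restrict (f \<circ> g) S \<in> Bij S"
proof -
  have "bij_betw (restrict (f \<circ> g) S) S S"
    by (rule bij_betw_byWitness[where f' = "g \<circ> f"]) (use assms in auto)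
  then show ?thesis by (simp add: Bij_def)
qed

lemma gens_Bij:
  "restrict (g_x A B C) (surf A B C D) \<in> Bij (surf A B C D)"
  "restrict (g_y A B C) (surf A B C D) \<in> Bij (surf A B C D)"
  "restrict (g_z A B C) (surf A B C D) \<in> Bij (surf A B C D)"
  unfolding g_x_def g_y_def g_z_def
  by (rule restrict_comp_Bij; simp add: s_x_surf s_y_surf s_z_surf)+

text \<open>By the next lemma, closures of subsets of the surface are the same in the surface and in the ambient space.\<close>

lemma closed_surf: "closed (surf A B C D)"
proof -
  have "surf A B C D = {p. fst p^2 + fst (snd p)^2 + snd (snd p)^2 + fst p * fst (snd p) * snd (snd p)
      = A * fst p + B * fst (snd p) + C * snd (snd p) + D}"
    by (auto simp: surf_def)
  also have "closed \<dots>" by (intro closed_Collect_eq continuous_intros)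
  finally show ?thesis .
qed

definition converges_to_infinity ::
    "'a::topological_space set \<Rightarrow> (nat \<Rightarrow> 'a \<Rightarrow> 'a) \<Rightarrow> 'a set \<Rightarrow> bool" where
  "converges_to_infinity S f U \<longleftrightarrow>
     (\<forall>V K. compact V \<and> V \<subseteq> U \<and> compact K \<and> K \<subseteq> S \<longrightarrow> finite {i. f i ` V \<inter> K \<noteq> {}})"

text \<open>For closed \<open>S\<close> and maps preserving \<open>S\<close>, the limit \<open>l\<close> automatically maps \<open>U\<close> into \<open>S\<close>.\<close>

definition converges_loc_unif ::
    "(nat \<Rightarrow> 'a \<Rightarrow> 'a::metric_space) \<Rightarrow> 'a set \<Rightarrow> bool" where
  "converges_loc_unif f U \<longleftrightarrow>
     (\<exists>l. \<forall>V. compact V \<and> V \<subseteq> U \<longrightarrow> uniform_limit V f l sequentially)"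

definition normal_family_on :: "'a::metric_space set \<Rightarrow> ('a \<Rightarrow> 'a) set \<Rightarrow> 'a set \<Rightarrow> bool" where
  "normal_family_on S F U \<longleftrightarrow>
     (\<forall>f :: nat \<Rightarrow> 'a \<Rightarrow> 'a. (\<forall>n. f n \<in> F) \<longrightarrow>
        (\<exists>r :: nat \<Rightarrow> nat. strict_mono r \<and>
           (converges_loc_unif (f \<circ> r) U \<or> converges_to_infinity S (f \<circ> r) U)))"

definition fatou :: "complex \<Rightarrow> complex \<Rightarrow> complex \<Rightarrow> complex \<Rightarrow> (complex \<times> complex \<times> complex) set" where
  "fatou A B C D = {p \<in> surf A B C D. \<exists>U. openin (top_of_set (surf A B C D)) U \<and> p \<in> U \<and>
     normal_family_on (surf A B C D) (grp A B C D) U}"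

definition julia :: "complex \<Rightarrow> complex \<Rightarrow> complex \<Rightarrow> complex \<Rightarrow> (complex \<times> complex \<times> complex) set" where
  "julia A B C D = surf A B C D - fatou A B C D"

definition grp_orbit :: "complex \<Rightarrow> complex \<Rightarrow> complex \<Rightarrow> complex \<Rightarrow> complex \<times> complex \<times> complex \<Rightarrow>
    (complex \<times> complex \<times> complex) set" where
  "grp_orbit A B C D p = {\<gamma> p | \<gamma>. \<gamma> \<in> grp A B C D}"

end

theory Submission
  imports Defs "HOL-Complex_Analysis.Complex_Analysis"
    "HOL-Computational_Algebra.Fundamental_Theorem_Algebra"
begin

text \<open>
  By Baire's theorem it suffices to show that any two open sets meeting the Julia set meet a
  common orbit in the Julia set. The map \<open>g\<^sub>x\<close> preserves the fibres of the first coordinate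
  \<open>x = - (\<mu> + 1/\<mu>)\<close>, which are conics on which it multiplies an eigencoordinate \<open>\<alpha>\<close> by \<open>\<mu>\<^sup>2\<close>.
  For \<open>x \<in> (-2, 2)\<close> this is a rotation, while it is hyperbolic on nearby fibres, so these fibres
  lie in the Julia set. Conversely, if the first coordinates of all images of an open set
  avoid \<open>[-2, 2]\<close>, the inverse Joukowski map makes them bounded and zero free, and Montel's and
  Hurwitz' theorems give normality; so every open set meeting the Julia set reaches a fibre
  over \<open>(-2, 2)\<close>. Finally, let two open sets meet the fibre over a generic such \<open>x\<close>. Perturbing
  \<open>\<mu>\<close> radially off the unit circle, some powers of \<open>g\<^sub>x\<close> move a given point of the fibre close to
  any prescribed ones, hence into both sets. The given point can be chosen so that \<open>g\<^sub>y\<inverse>\<close> maps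
  its perturbations into the fibre over any prescribed \<open>x'\<close>.
\<close>

section \<open>Montel and Hurwitz along complex lines\<close>

text \<open>On a fibre over \<open>(-2, 2)\<close> the powers of \<open>g_x\<close> preserve the
  modulus of \<open>\<alpha>\<close>, so they cannot join different circles of the fibre; leaving
  the unit circle supplies the missing drift in modulus. But then the moving points lie off the
  slit, where nothing says that they belong to the Julia set, so their orbit has to be brought back
  to a generic fibre. One identity does this: the inverse of \<open>g_y\<close> replaces the first
  coordinate x by A - x - yz. Prescribing both values fixes the product yz and turns the surface
  equation into a monic quartic in y, whose roots can be followed as x varies. The same identity is
  why first coordinates alone decide normality: on the surface, bounds on x and on A - x - yz bound
  y and z as well. The centres of degenerate fibres, where both eigencoordinates vanish, escape the
  parametrisation and get their own argument.\<close>

definition cline :: "complex \<times> complex \<Rightarrow> complex \<times> complex \<Rightarrow> complex \<Rightarrow> complex \<times> complex" where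
  "cline a b t = (fst a + t * fst b, snd a + t * snd b)"

text \<open>Holomorphy along all complex lines suffices below, so no theory of several complex
  variables is needed.\<close>

definition line_hol :: "(complex \<times> complex \<Rightarrow> complex) \<Rightarrow> (complex \<times> complex) set \<Rightarrow> bool" where
  "line_hol f T \<longleftrightarrow> (\<forall>a b. (\<lambda>t. f (cline a b t)) holomorphic_on (cline a b -` T))"

lemma line_holD: "line_hol f T \<Longrightarrow> (\<lambda>t. f (cline a b t)) holomorphic_on (cline a b -` T)"
  unfolding line_hol_def by blast

lemma line_hol_subset: "line_hol f T \<Longrightarrow> T' \<subseteq> T \<Longrightarrow> line_hol f T'"
  unfolding line_hol_def by (meson holomorphic_on_subset vimage_mono)

lemma line_hol_const: "line_hol (\<lambda>_. c) T"
  by (simp add: line_hol_def)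

lemma cline_diff: "norm (cline a b s - cline a b t) = norm (s - t) * norm b"
proof -
  have "cline a b s - cline a b t = ((s - t) * fst b, (s - t) * snd b)"
    by (simp add: cline_def algebra_simps)
  then show ?thesis
    by (cases b) (simp add: norm_Pair norm_mult power_mult_distrib real_sqrt_mult flip: distrib_left)
qed

lemma cline_0 [simp]: "cline a b 0 = a" and cline_1 [simp]: "cline a (b - a) 1 = b"
  by (simp_all add: cline_def)

lemma continuous_cline: "continuous_on T (cline a b)"
  unfolding cline_def by (intro continuous_intros)

lemma convex_cline_vimage:
  assumes "convex T"
  shows "convex (cline a b -` T)"
  unfolding convex_alt
proof (intro ballI allI impI)
  fix s t and u :: real
  assume "s \<in> cline a b -` T" "t \<in> cline a b -` T" "0 \<le> u \<and> u \<le> 1"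
  then have "(1 - u) *\<^sub>R cline a b s + u *\<^sub>R cline a b t \<in> T"
    using assms by (auto simp: convex_alt)
  also have "(1 - u) *\<^sub>R cline a b s + u *\<^sub>R cline a b t = cline a b ((1 - u) *\<^sub>R s + u *\<^sub>R t)"
    by (simp add: cline_def scaleR_conv_of_real algebra_simps)
  finally show "(1 - u) *\<^sub>R s + u *\<^sub>R t \<in> cline a b -` T" by simp
qed

text \<open>The Schwarz lemma on the complex line through \<open>x\<close> and \<open>y\<close>,
  rescaled so that the unit disc fills the ball. The constant is the same for all functions bounded
  by \<open>M\<close>, which is what equicontinuity needs.\<close>

lemma line_hol_lipschitz:
  assumes hol: "line_hol f (ball x \<rho>)" and bd: "\<And>z. z \<in> ball x \<rho> \<Longrightarrow> norm (f z) \<le> M"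
    and y: "y \<in> ball x \<rho>"
  shows "norm (f y - f x) \<le> (2 * M + 1) / \<rho> * norm (y - x)"
proof (cases "y = x")
  case False
  define d where "d = norm (y - x)"
  have d: "0 < d" "d < \<rho>" using False y by (auto simp: d_def dist_norm norm_minus_commute)
  then have \<rho>: "\<rho> > 0" by linarith
  have "norm (f x) \<le> M" using bd \<rho> by simp
  then have M: "M \<ge> 0" using norm_ge_zero order_trans by blast
  \<comment> \<open>Dividing by \<open>2 * M + 1\<close> rather than \<open>2 * M\<close> gives the
    strict bound that the Schwarz lemma asks for, and a nonzero divisor when \<open>M = 0\<close>.
    The point \<open>y\<close> sits at the parameter \<open>d / \<rho>\<close>.\<close>
  define \<phi> where "\<phi> t = (f (cline x (y - x) (of_real (\<rho> / d) * t)) - f x) / of_real (2 * M + 1)" for t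
  have inb: "cline x (y - x) (of_real (\<rho> / d) * t) \<in> ball x \<rho>" if "norm t < 1" for t
  proof -
    have "norm (cline x (y - x) (of_real (\<rho> / d) * t) - cline x (y - x) 0) = \<rho> / d * norm t * d"
      unfolding cline_diff using d \<rho> by (simp add: norm_mult norm_divide d_def)
    then have "dist x (cline x (y - x) (of_real (\<rho> / d) * t)) = \<rho> * norm t"
      using d by (simp add: dist_norm norm_minus_commute)
    then show ?thesis using that \<rho> by simp
  qed
  have "((\<lambda>s. f (cline x (y - x) s)) \<circ> (\<lambda>t. of_real (\<rho> / d) * t)) holomorphic_on ball 0 1"
  proof (rule holomorphic_on_compose_gen)
    show "(\<lambda>s. f (cline x (y - x) s)) holomorphic_on (cline x (y - x) -` ball x \<rho>)"
      by (rule line_holD[OF hol])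
    show "(\<lambda>t. of_real (\<rho> / d) * t) ` ball 0 1 \<subseteq> cline x (y - x) -` ball x \<rho>" 
      using inb by auto
  qed (intro holomorphic_intros)
  moreover have nz: "complex_of_real (2 * M + 1) \<noteq> 0" using M by (simp only: of_real_eq_0_iff)
  ultimately have "\<phi> holomorphic_on ball 0 1"
    unfolding \<phi>_def comp_def by (intro holomorphic_intros)
  moreover have "\<phi> 0 = 0" by (simp add: \<phi>_def)
  moreover have "norm (\<phi> t) < 1" if "norm t < 1" for t
  proof -
    have "norm (f (cline x (y - x) (of_real (\<rho> / d) * t)) - f x) \<le> M + M"
      using bd[OF inb[OF that]] bd[of x] \<rho> norm_triangle_ineq4 order_trans add_mono by (metis centre_in_ball)
    also have "\<dots> < 2 * M + 1" by simp
    finally show ?thesis using M unfolding \<phi>_def norm_divide norm_of_real by (simp add: divide_simps)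
  qed
  moreover have "norm (complex_of_real (d / \<rho>)) < 1" using d \<rho> unfolding norm_of_real by simp
  ultimately have "norm (\<phi> (of_real (d / \<rho>))) \<le> norm (complex_of_real (d / \<rho>))"
    by (rule Schwarz_Lemma(1))
  moreover have "\<phi> (of_real (d / \<rho>)) = (f y - f x) / of_real (2 * M + 1)"
  proof -
    have "complex_of_real (\<rho> / d) * of_real (d / \<rho>) = 1" using d \<rho> by (simp flip: of_real_mult)
    then show ?thesis by (simp only: \<phi>_def cline_1)
  qed
  ultimately have "norm (f y - f x) / (2 * M + 1) \<le> d / \<rho>"
    using d \<rho> M by (simp add: norm_divide del: of_real_add of_real_mult)
  then show ?thesis using M \<rho> by (simp add: d_def field_simps)
qed simp

lemma norm_triple_le: "norm p \<le> norm (fst p) + norm (fst (snd p)) + norm (snd (snd p))"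
  using norm_Pair_le[of "fst p" "snd p"] norm_Pair_le[of "fst (snd p)" "snd (snd p)"] by simp

text \<open>Near every point of the smaller ball the three components are Lipschitz with a constant
  independent of \<open>n\<close>; this equicontinuity and the bound \<open>M\<close> feed
  Arzela-Ascoli.\<close>

lemma Montel_line_hol:
  fixes F :: "nat \<Rightarrow> complex \<times> complex \<Rightarrow> complex \<times> complex \<times> complex"
  assumes hol: "\<And>n. line_hol (\<lambda>z. fst (F n z)) (ball c R)" "\<And>n. line_hol (\<lambda>z. fst (snd (F n z))) (ball c R)"
      "\<And>n. line_hol (\<lambda>z. snd (snd (F n z))) (ball c R)"
    and bd: "\<And>n z. z \<in> ball c R \<Longrightarrow> norm (F n z) \<le> M" and r: "r < R"
  shows "\<exists>k g. strict_mono (k :: nat \<Rightarrow> nat) \<and> continuous_on (cball c r) g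
    \<and> uniform_limit (cball c r) (F \<circ> k) g sequentially"
proof -
  define \<rho> where "\<rho> = R - r"
  have \<rho>: "\<rho> > 0" using r by (simp add: \<rho>_def)
  have sub: "ball x \<rho> \<subseteq> ball c R" if "x \<in> cball c r" for x
  proof
    fix y assume "y \<in> ball x \<rho>"
    then show "y \<in> ball c R" using that dist_triangle[of c y x] by (simp add: \<rho>_def)
  qed
  have lip: "norm (F n y - F n x) \<le> 3 * ((2 * \<bar>M\<bar> + 1) / \<rho> * norm (y - x))"
    if x: "x \<in> cball c r" and y: "y \<in> ball x \<rho>" for n x y
  proof -
    have comp: "norm (fst p) \<le> norm p" "norm (fst (snd p)) \<le> norm p" "norm (snd (snd p)) \<le> norm p"
      for p :: "complex \<times> complex \<times> complex"
      using norm_fst_le[of "fst p" "snd p"] norm_fst_le[of "fst (snd p)" "snd (snd p)"]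
        norm_snd_le[of "snd (snd p)" "fst (snd p)"] norm_snd_le[of "snd p" "fst p"] by simp_all
    have bd': "norm (F n z) \<le> \<bar>M\<bar>" if "z \<in> ball x \<rho>" for z
      using bd[of z n] sub[OF x] that by force
    note bdc = comp[THEN order_trans, OF bd']
    have 1: "norm (fst (F n y) - fst (F n x)) \<le> (2 * \<bar>M\<bar> + 1) / \<rho> * norm (y - x)"
      by (rule line_hol_lipschitz[OF line_hol_subset[OF hol(1) sub[OF x]] _ y]) (rule bdc)
    have 2: "norm (fst (snd (F n y)) - fst (snd (F n x))) \<le> (2 * \<bar>M\<bar> + 1) / \<rho> * norm (y - x)"
      by (rule line_hol_lipschitz[OF line_hol_subset[OF hol(2) sub[OF x]] _ y]) (rule bdc)
    have 3: "norm (snd (snd (F n y)) - snd (snd (F n x))) \<le> (2 * \<bar>M\<bar> + 1) / \<rho> * norm (y - x)"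
      by (rule line_hol_lipschitz[OF line_hol_subset[OF hol(3) sub[OF x]] _ y]) (rule bdc)
    have "norm (F n y - F n x) \<le> norm (fst (F n y - F n x)) + norm (fst (snd (F n y - F n x))) + norm (snd (snd (F n y - F n x)))"
      by (rule norm_triple_le)
    then show ?thesis using 1 2 3 by simp
  qed
  obtain g k where gk: "continuous_on (cball c r) g" "strict_mono (k :: nat \<Rightarrow> nat)"
    "\<And>e. 0 < e \<Longrightarrow> \<exists>N. \<forall>n x. n \<ge> N \<and> x \<in> cball c r \<longrightarrow> norm (F (k n) x - g x) < e"
  proof (rule Arzela_Ascoli[of "cball c r" F M])
    show "norm (F n x) \<le> M" if "x \<in> cball c r" for n x
      using bd that r by simp
    fix x e assume x: "x \<in> cball c r" and e: "(0::real) < e"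
    define L where "L = 3 * ((2 * \<bar>M\<bar> + 1) / \<rho>)"
    have L: "L > 0" using \<rho> by (simp add: L_def)
    have "norm (F n x - F n y) < e" if "norm (x - y) < min \<rho> (e / L)" for n y
    proof -
      have "norm (F n y - F n x) \<le> L * norm (y - x)"
        using lip[OF x, of y n] that by (simp only: L_def dist_norm mem_ball mult.assoc min_less_iff_conj)
      also have "\<dots> < e" using that L by (simp add: norm_minus_commute field_simps)
      finally show ?thesis by (simp add: norm_minus_commute)
    qed
    then show "\<exists>d>0. \<forall>n y. y \<in> cball c r \<and> norm (x - y) < d \<longrightarrow> norm (F n x - F n y) < e"
      using \<rho> e L by (intro exI[of _ "min \<rho> (e / L)"]) auto
  qed (use that in auto)
  have "uniform_limit (cball c r) (F \<circ> k) g sequentially"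
  proof (rule uniform_limitI)
    fix e :: real assume "e > 0"
    then obtain N where N: "\<forall>n x. n \<ge> N \<and> x \<in> cball c r \<longrightarrow> norm (F (k n) x - g x) < e"
      using gk(3) by blast
    show "\<forall>\<^sub>F n in sequentially. \<forall>x\<in>cball c r. dist ((F \<circ> k) n x) (g x) < e"
      unfolding eventually_sequentially dist_norm comp_def using N by blast
  qed
  with gk show ?thesis by blast
qed

text \<open>On the complex line through \<open>z\<close> and \<open>w\<close>, a limit vanishing at
  \<open>z\<close> but not at \<open>w\<close> would be nonconstant, so the one-variable theorem
  forbids its zero. The part of the line inside the ball is convex, hence connected, as that theorem
  requires.\<close>

lemma line_hol_Hurwitz:
  assumes hol: "\<And>n. line_hol (f n) (ball c r)" and ul: "uniform_limit (ball c r) f g sequentially"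
    and nz: "\<And>n z. z \<in> ball c r \<Longrightarrow> f n z \<noteq> 0"
    and z: "z \<in> ball c r" "g z = 0" and w: "w \<in> ball c r"
  shows "g w = 0"
proof (rule ccontr)
  assume gw: "g w \<noteq> 0"
  let ?L = "cline z (w - z)"
  let ?T = "?L -` ball c r"
  have T: "open ?T" "connected ?T"
    using continuous_open_vimage[OF open_ball] continuous_cline[of UNIV]
      convex_connected[OF convex_cline_vimage[OF convex_ball]]
    by (auto simp: open_vimage)
  have hol': "(\<lambda>t. f n (?L t)) holomorphic_on ?T" for n by (rule line_holD[OF hol])
  have ul': "uniform_limit ?T (\<lambda>n t. f n (?L t)) (\<lambda>t. g (?L t)) sequentially"
  proof (rule uniform_limitI)
    fix e :: real assume "e > 0"
    from uniform_limitD[OF ul this]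
    show "\<forall>\<^sub>F n in sequentially. \<forall>x\<in>?T. dist (f n (?L x)) (g (?L x)) < e"
      by eventually_elim blast
  qed
  have "(\<lambda>t. g (?L t)) holomorphic_on ?T"
  proof (rule holomorphic_uniform_sequence[OF T(1) hol'])
    fix x assume "x \<in> ?T"
    then obtain d where "d > 0" "cball x d \<subseteq> ?T" using T(1) open_contains_cball by blast
    then show "\<exists>d>0. cball x d \<subseteq> ?T \<and> uniform_limit (cball x d) (\<lambda>n t. f n (?L t)) (\<lambda>t. g (?L t)) sequentially"
      using uniform_limit_on_subset[OF ul'] by blast
  qed
  moreover have "\<not> (\<lambda>t. g (?L t)) constant_on ?T"
  proof
    assume "(\<lambda>t. g (?L t)) constant_on ?T"
    moreover have "0 \<in> ?T" "1 \<in> ?T" using z w by auto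
    ultimately have "g (?L 0) = g (?L 1)" unfolding constant_on_def by metis
    then show False using z gw by simp
  qed
  ultimately have "g (?L 0) \<noteq> 0"
    by (intro Hurwitz_no_zeros[where \<F> = "\<lambda>n t. f n (?L t)" and g = "\<lambda>t. g (?L t)" and ?z0.0 = 0, OF T hol'] uniform_limit_on_subset[OF ul'])
      (use nz z in auto)
  then show False using z by simp
qed

section \<open>The slit and the inverse Joukowski map\<close>

definition slit :: "complex set" where "slit = complex_of_real ` {-2..2}"

text \<open>The root of \<open>\<mu>^2 + x * \<mu> + 1\<close> inside the unit disc. Writing the
  square root of the discriminant as \<open>x * csqrt (1 - 4 / x^2)\<close> puts the branch cut
  inside the slit, so one formula is holomorphic on the whole complement.\<close>

definition joukowski_inv :: "complex \<Rightarrow> complex" where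
  "joukowski_inv x = - (x / 2) * (1 - csqrt (1 - 4 / x^2))"

lemma slit_arg:
  assumes "x \<notin> slit"
  shows "x \<noteq> 0" "1 - 4 / x^2 \<notin> \<real>\<^sub>\<le>\<^sub>0"
proof -
  show x0: "x \<noteq> 0" using assms by (force simp: slit_def)
  show "1 - 4 / x^2 \<notin> \<real>\<^sub>\<le>\<^sub>0"
  proof
    assume "1 - 4 / x^2 \<in> \<real>\<^sub>\<le>\<^sub>0"
    then obtain t where t: "1 - 4 / x^2 = of_real t" "t \<le> 0" by (elim nonpos_Reals_cases)
    then have "4 = (1 - of_real t) * x^2" using x0 by (simp add: field_simps flip: t(1))
    moreover have "1 - complex_of_real t \<noteq> 0" using t(2) by (metis diff_eq_diff_eq diff_self eq_iff_diff_eq_0 not_one_le_zero of_real_1 of_real_eq_iff)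
    ultimately have x2: "x^2 = of_real (4 / (1 - t))" by (simp add: field_simps)
    define u where "u = sqrt (4 / (1 - t))"
    have "0 \<le> 4 / (1 - t)" "4 / (1 - t) \<le> 4" using t(2) by (auto simp: field_simps)
    then have u: "0 \<le> u" "u \<le> 2" "u^2 = 4 / (1 - t)"
      using real_sqrt_le_mono[of "4 / (1 - t)" "2^2"] by (auto simp: u_def simp del: real_sqrt_le_iff)
    then have "x^2 = (of_real u)^2" using x2 by (simp flip: of_real_power)
    then have "x = of_real u \<or> x = of_real (- u)" by (simp add: power2_eq_iff)
    then show False using assms u unfolding slit_def by (metis atLeastAtMost_iff imageI neg_le_iff_le order_trans minus_le_iff neg_0_le_iff_le zero_le_numeral)
  qed
qed

lemma joukowski_inv_hol: "joukowski_inv holomorphic_on (- slit)"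
  unfolding joukowski_inv_def
  by (intro holomorphic_intros holomorphic_on_csqrt') (use slit_arg in auto)

text \<open>The two roots \<open>j\<close> and \<open>m\<close> have product 1. Off the branch cut
  \<open>Re s > 0\<close>, so \<open>1 - s\<close> is shorter than \<open>1 + s\<close>, and
  \<open>j\<close> is the root of smaller modulus.\<close>

lemma joukowski_inv:
  assumes "x \<notin> slit"
  shows "joukowski_inv x \<noteq> 0" "norm (joukowski_inv x) < 1"
    "x = - (joukowski_inv x + 1 / joukowski_inv x)"
proof -
  define s where "s = csqrt (1 - 4 / x^2)"
  note x = slit_arg[OF assms]
  have s2: "s^2 = 1 - 4 / x^2" by (simp add: s_def)
  have "Re s > 0"
  proof (rule ccontr)
    assume "\<not> Re s > 0"
    moreover have "Re s \<ge> 0" using csqrt_principal[of "1 - 4 / x^2"] by (auto simp: s_def)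
    ultimately have "Re s = 0" by simp
    then have "s^2 = of_real (- ((Im s)^2))" by (simp add: complex_eq_iff power2_eq_square)
    then show False using x(2) s2 by (metis neg_le_0_iff_le nonpos_Reals_of_real_iff zero_le_power2)
  qed
  define j m where "j = - (x / 2) * (1 - s)" and "m = - (x / 2) * (1 + s)"
  have j: "joukowski_inv x = j" by (simp add: joukowski_inv_def j_def s_def)
  have "j * m = x^2 / 4 * (1 - s^2)" by (simp add: j_def m_def power2_eq_square algebra_simps)
  then have jm: "j * m = 1" using x(1) by (simp add: s2)
  show j0: "joukowski_inv x \<noteq> 0" using jm j by auto
  have m: "m = 1 / j" using jm by (metis mult_zero_left nonzero_mult_div_cancel_left zero_neq_one)
  have "j + m = - (x / 2) * 2" unfolding j_def m_def distrib_left[symmetric] by simp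
  then have "j + m = - x" by simp
  then show "x = - (joukowski_inv x + 1 / joukowski_inv x)" using m j by simp
  have "(norm (1 - s))^2 < (norm (1 + s))^2"
    using \<open>Re s > 0\<close> unfolding cmod_power2 by (simp add: power2_eq_square algebra_simps)
  then have "norm (1 - s) < norm (1 + s)" by (rule power2_less_imp_less) simp
  then have "norm j < norm m" using x(1) by (simp add: j_def m_def norm_mult)
  moreover have "norm j * norm m = 1" using jm by (metis norm_mult norm_one)
  ultimately show "norm (joukowski_inv x) < 1"
    unfolding j using mult_right_mono[of 1 "norm j" "norm m"] by fastforce
qed

lemma joukowski_inv_bounds:
  assumes "x \<notin> slit"
  shows "norm x \<le> 1 / norm (joukowski_inv x) + 1" "1 / norm (joukowski_inv x) \<le> norm x + 1"
proof -
  note j = joukowski_inv[OF assms]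
  let ?j = "joukowski_inv x"
  have "norm x \<le> norm ?j + norm (1 / ?j)"
    by (subst j(3)) (simp only: norm_minus_cancel norm_triangle_ineq)
  then show "norm x \<le> 1 / norm ?j + 1" using j(2) by (simp add: norm_divide)
  have "1 / ?j = - x - ?j" using j(3) by (metis add_diff_cancel_left' minus_minus)
  then have "norm (1 / ?j) \<le> norm x + norm ?j" using norm_triangle_ineq4[of "- x" ?j] by simp
  then show "1 / norm ?j \<le> norm x + 1" using j(2) by (simp add: norm_divide)
qed

text \<open>By Hurwitz the limit of the zero-free functions \<open>h\<close> is either identically
  zero or zero free. Since \<open>h\<close> is small where \<open>X\<close> is large, the first case
  means uniform escape and the second, by compactness, a uniform bound.\<close>

lemma slit_omitting_dichotomy:
  fixes X :: "nat \<Rightarrow> complex \<times> complex \<Rightarrow> complex"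
  assumes hol: "\<And>n. line_hol (X n) (ball c R)" and om: "\<And>n z. z \<in> ball c R \<Longrightarrow> X n z \<notin> slit"
    and r: "0 < r" "r < R"
  shows "\<exists>k. strict_mono k \<and>
    ((\<forall>M. \<forall>\<^sub>F n in sequentially. \<forall>z\<in>ball c r. norm (X (k n) z) > M) \<or>
     (\<exists>M. \<forall>\<^sub>F n in sequentially. \<forall>z\<in>ball c r. norm (X (k n) z) \<le> M))"
proof -
  define h where "h n z = joukowski_inv (X n z)" for n z
  have holh: "line_hol (h n) (ball c R)" for n
    unfolding line_hol_def h_def
  proof (intro allI)
    fix a b
    have "(joukowski_inv \<circ> (\<lambda>t. X n (cline a b t))) holomorphic_on (cline a b -` ball c R)"
      by (rule holomorphic_on_compose_gen[OF _ joukowski_inv_hol]) (use line_holD[OF hol] om in auto)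
    then show "(\<lambda>t. joukowski_inv (X n (cline a b t))) holomorphic_on (cline a b -` ball c R)"
      by (simp add: comp_def)
  qed
  have h: "h n z \<noteq> 0" "norm (h n z) < 1" if "z \<in> ball c R" for n z
    using joukowski_inv om[OF that] by (auto simp: h_def)
  \<comment> \<open>The intermediate radius leaves room twice: Montel shrinks \<open>R\<close> to
    \<open>r'\<close>, Hurwitz works on the open ball of radius \<open>r'\<close>, and the limit
    attains its minimum modulus on the closed ball of radius \<open>r\<close> inside it.\<close>
  define r' where "r' = (r + R) / 2"
  have r': "r < r'" "r' < R" using r by (auto simp: r'_def)
  \<comment> \<open>\<open>Montel_line_hol\<close> speaks of triples, so the scalar functions are
    padded with zeros.\<close>
  define H where "H n z = (h n z, 0::complex, 0::complex)" for n z
  have H: "line_hol (\<lambda>z. fst (H n z)) (ball c R)" "line_hol (\<lambda>z. fst (snd (H n z))) (ball c R)"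
    "line_hol (\<lambda>z. snd (snd (H n z))) (ball c R)" for n
    by (simp_all add: H_def holh line_hol_const)
  have bdH: "norm (H n z) \<le> 1" if "z \<in> ball c R" for n z
    using h(2)[OF that, of n] by (simp add: H_def norm_Pair)
  have "\<exists>k g. strict_mono (k :: nat \<Rightarrow> nat) \<and> continuous_on (cball c r') g \<and> uniform_limit (cball c r') (H \<circ> k) g sequentially"
    by (rule Montel_line_hol[OF H bdH r'(2)])
  then obtain k where "\<exists>g. strict_mono (k :: nat \<Rightarrow> nat) \<and> continuous_on (cball c r') g \<and> uniform_limit (cball c r') (H \<circ> k) g sequentially"
    by (rule exE)
  then obtain g where "strict_mono k \<and> continuous_on (cball c r') g \<and> uniform_limit (cball c r') (H \<circ> k) g sequentially"
    by (rule exE)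
  then have gk: "strict_mono k" "continuous_on (cball c r') g" "uniform_limit (cball c r') (H \<circ> k) g sequentially"
    by simp_all
  define g' where "g' z = fst (g z)" for z
  have ul: "uniform_limit (cball c r') (\<lambda>n. h (k n)) g' sequentially"
  proof (rule uniform_limitI)
    fix e :: real assume "e > 0"
    from uniform_limitD[OF gk(3) this] show "\<forall>\<^sub>F n in sequentially. \<forall>x\<in>cball c r'. dist (h (k n) x) (g' x) < e"
    proof eventually_elim
      case (elim n)
      show ?case
      proof
        fix x assume "x \<in> cball c r'"
        then have "dist (H (k n) x) (g x) < e" using elim by simp
        with dist_fst_le[of "H (k n) x" "g x"] show "dist (h (k n) x) (g' x) < e"
          by (simp add: g'_def H_def)
      qed
    qed
  qed
  have bl: "ball c r \<subseteq> cball c r'" "cball c r \<subseteq> ball c r'" "ball c r' \<subseteq> ball c R" using r' by auto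
  consider "\<And>z. z \<in> ball c r' \<Longrightarrow> g' z = 0" | "\<And>z. z \<in> ball c r' \<Longrightarrow> g' z \<noteq> 0"
    using line_hol_Hurwitz[of "\<lambda>n. h (k n)" c r' g'] line_hol_subset[OF holh bl(3)] h bl(3)
      uniform_limit_on_subset[OF ul ball_subset_cball] by (metis subset_iff)
  then show ?thesis
  proof cases
    case 1
    have "\<forall>\<^sub>F n in sequentially. \<forall>z\<in>ball c r. norm (X (k n) z) > M" for M
    proof -
      have "1 / (\<bar>M\<bar> + 2) > 0" by simp
      from uniform_limitD[OF ul this] show ?thesis
      proof eventually_elim
        case (elim n)
        show ?case
        proof
          fix z assume z: "z \<in> ball c r"
          then have "z \<in> cball c r'" "z \<in> ball c R" "g' z = 0" using 1[of z] r' by auto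
          moreover from this have "norm (h (k n) z) < 1 / (\<bar>M\<bar> + 2)" using elim by fastforce
          moreover from calculation have "h (k n) z \<noteq> 0" using h by blast
          ultimately have "\<bar>M\<bar> + 2 < 1 / norm (h (k n) z)" by (simp add: field_simps)
          also have "\<dots> \<le> norm (X (k n) z) + 1"
            using joukowski_inv_bounds(2) om[OF \<open>z \<in> ball c R\<close>] by (simp add: h_def)
          finally show "norm (X (k n) z) > M" by linarith
        qed
      qed
    qed
    then show ?thesis using gk(1) by blast
  next
    case 2
    have "continuous_on (cball c r) (\<lambda>z. norm (g' z))"
      unfolding g'_def using gk(2) r' by (intro continuous_intros) (auto elim: continuous_on_subset)
    then obtain z0 where z0: "z0 \<in> cball c r" "\<And>z. z \<in> cball c r \<Longrightarrow> norm (g' z0) \<le> norm (g' z)"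
      using continuous_attains_inf[OF compact_cball, of c r] r by fastforce
    define \<delta> where "\<delta> = norm (g' z0) / 2"
    have \<delta>: "\<delta> > 0" using 2[of z0] z0 bl by (auto simp: \<delta>_def)
    from uniform_limitD[OF ul this]
    have "\<forall>\<^sub>F n in sequentially. \<forall>z\<in>ball c r. norm (X (k n) z) \<le> 1 / \<delta> + 1"
    proof eventually_elim
      case (elim n)
      show ?case
      proof
        fix z assume z: "z \<in> ball c r"
        then have zz: "z \<in> cball c r" "z \<in> cball c r'" "z \<in> ball c R" using r' by auto
        have "norm (g' z) - norm (h (k n) z) \<le> norm (h (k n) z - g' z)"
          by (metis norm_minus_commute norm_triangle_ineq2)
        then have "\<delta> < norm (h (k n) z)"
          using elim[rule_format, OF zz(2)] z0(2)[OF zz(1)] unfolding dist_norm \<delta>_def by linarith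
        then have "1 / norm (h (k n) z) \<le> 1 / \<delta>" using \<delta> by (intro frac_le) auto
        then show "norm (X (k n) z) \<le> 1 / \<delta> + 1"
          using joukowski_inv_bounds(1)[OF om[OF zz(3), of "k n"]] by (simp add: h_def)
      qed
    qed
    then show ?thesis using gk(1) by blast
  qed
qed

lemma closed_slit: "closed slit"
  unfolding slit_def by (intro compact_imp_closed compact_continuous_image continuous_intros compact_Icc)

section \<open>Roots of monic polynomials and irrational rotations\<close>

text \<open>The norm of \<open>poly p z\<close> is the product of the distances from
  \<open>z\<close> to the roots, hence at least the corresponding power of the smallest
  distance.\<close>

lemma monic_root_near:
  fixes p :: "complex poly"
  assumes "lead_coeff p = 1" "degree p > 0"
  shows "\<exists>w. poly p w = 0 \<and> norm (w - z) ^ degree p \<le> norm (poly p z)"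
proof -
  obtain root where root: "smult (lead_coeff p) (\<Prod>i<degree p. [:-root i, 1:]) = p"
    using complex_poly_decompose' by blast
  have pz: "poly p w = (\<Prod>i<degree p. w - root i)" for w
    by (subst root[symmetric]) (simp add: assms(1) poly_prod)
  let ?I = "{..<degree p}"
  obtain i where i: "i \<in> ?I" "\<And>j. j \<in> ?I \<Longrightarrow> norm (root i - z) \<le> norm (root j - z)"
    using ex_min_if_finite[of "(\<lambda>i. norm (root i - z)) ` ?I"] assms(2)
    by (auto simp: not_less)
  have "norm (root i - z) ^ degree p = (\<Prod>j\<in>?I. norm (root i - z))" by simp
  also have "\<dots> \<le> (\<Prod>j\<in>?I. norm (root j - z))" by (rule prod_mono) (use i in auto)
  also have "\<dots> = norm (poly p z)" by (simp add: pz prod_norm norm_minus_commute)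
  finally show ?thesis using i(1) by (auto simp: pz)
qed

text \<open>Lets points of the surface follow a varying first coordinate, even at a multiple root,
  where the implicit function theorem gives nothing.\<close>

lemma monic_roots_tendsto:
  fixes p :: "nat \<Rightarrow> complex poly"
  assumes "\<And>k. lead_coeff (p k) = 1" "\<And>k. degree (p k) = n" "n > 0"
    and lim: "(\<lambda>k. poly (p k) z) \<longlonglongrightarrow> 0"
  shows "\<exists>w. (\<forall>k. poly (p k) (w k) = 0) \<and> w \<longlonglongrightarrow> z"
proof -
  have "\<forall>k. \<exists>w. poly (p k) w = 0 \<and> norm (w - z) ^ n \<le> norm (poly (p k) z)"
    using monic_root_near assms(1-3) by metis
  then obtain w where w: "\<And>k. poly (p k) (w k) = 0" "\<And>k. norm (w k - z) ^ n \<le> norm (poly (p k) z)"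
    by metis
  have "(\<lambda>k. norm (w k - z) ^ n) \<longlonglongrightarrow> 0"
    by (rule tendsto_sandwich[OF _ _ tendsto_const tendsto_norm_zero[OF lim]]) (use w in auto)
  then have "(\<lambda>k. root n (norm (w k - z) ^ n)) \<longlonglongrightarrow> root n 0"
    by (rule tendsto_real_root)
  then have "(\<lambda>k. norm (w k - z)) \<longlonglongrightarrow> 0" using assms(3) by (simp add: real_root_power_cancel)
  then have "w \<longlonglongrightarrow> z" by (intro LIM_zero_cancel[of w]) (rule tendsto_norm_zero_cancel)
  with w show ?thesis by blast
qed

section \<open>Irrational rotations\<close>

lemma frac_rotation:
  "cis (2 * pi * \<theta>) ^ k = cis (2 * pi * frac (real k * \<theta>))"
proof -
  have "2 * pi * (real k * \<theta>) = 2 * pi * frac (real k * \<theta>) + 2 * pi * of_int \<lfloor>real k * \<theta>\<rfloor>"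
    by (simp add: frac_def algebra_simps)
  then have "cis (2 * pi * (real k * \<theta>)) = cis (2 * pi * frac (real k * \<theta>)) * cis (2 * pi * of_int \<lfloor>real k * \<theta>\<rfloor>)"
    by (simp only: cis_mult)
  also have "cis (2 * pi * of_int \<lfloor>real k * \<theta>\<rfloor>) = 1" by simp
  finally show ?thesis by (simp add: Complex.DeMoivre mult.left_commute)
qed

lemma irrational_rotation_dense:
  assumes "\<theta> \<notin> \<rat>" "\<epsilon> > 0"
  shows "\<exists>k>0. norm (cis (2 * pi * \<theta>) ^ k - cis \<tau>) < \<epsilon>"
proof -
  define t where "t = frac (\<tau> / (2 * pi))"
  have "2 * pi * (\<tau> / (2 * pi)) = 2 * pi * t + 2 * pi * of_int \<lfloor>\<tau> / (2 * pi)\<rfloor>"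
    by (simp add: t_def frac_def algebra_simps)
  then have "cis \<tau> = cis (2 * pi * t) * cis (2 * pi * of_int \<lfloor>\<tau> / (2 * pi)\<rfloor>)"
    by (simp only: cis_mult) simp
  then have t: "cis \<tau> = cis (2 * pi * t)" by simp
  have "((\<lambda>s. cis (2 * pi * s)) \<longlongrightarrow> cis (2 * pi * t)) (at t)"
    unfolding cis_conv_exp by (intro tendsto_intros)
  then obtain d where d: "d > 0" "\<And>s. \<bar>s - t\<bar> < d \<Longrightarrow> norm (cis (2 * pi * s) - cis (2 * pi * t)) < \<epsilon>"
    using assms(2) unfolding LIM_eq by (metis cancel_comm_monoid_add_class.diff_cancel norm_zero real_norm_def)
  have "0 \<le> t" "t \<le> 1" by (auto simp: t_def frac_ge_0 less_imp_le[OF frac_lt_1])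
  then obtain k where "k > 0" "\<bar>frac (real k * \<theta>) - t\<bar> < d"
    using Kronecker_approx_1_explicit[OF assms(1) _ _ d(1)] by metis
  then show ?thesis using d(2) unfolding t frac_rotation by blast
qed

text \<open>Density is applied to the irrational angle \<open>real (Suc k) * \<theta>\<close>: the
  return time is then a positive multiple of \<open>Suc k\<close>, so the times \<open>N k\<close>
  tend to infinity.\<close>

lemma irrational_rotation_returns:
  assumes "\<theta> \<notin> \<rat>"
  shows "\<exists>N :: nat \<Rightarrow> nat. (\<forall>k. N k > k) \<and> (\<lambda>k. cis (2 * pi * \<theta>) ^ N k) \<longlonglongrightarrow> 1"
proof -
  have "\<exists>N>k. norm (cis (2 * pi * \<theta>) ^ N - 1) < 1 / Suc k" for k :: nat
  proof -
    have "real (Suc k) * \<theta> \<notin> \<rat>"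
    proof
      assume "real (Suc k) * \<theta> \<in> \<rat>"
      then have "real (Suc k) * \<theta> / real (Suc k) \<in> \<rat>" by (intro Rats_divide Rats_of_nat)
      then show False using assms by (simp del: of_nat_Suc)
    qed
    then obtain m where m: "m > 0" "norm (cis (2 * pi * (real (Suc k) * \<theta>)) ^ m - cis 0) < 1 / Suc k"
      using irrational_rotation_dense[of "real (Suc k) * \<theta>" "1 / Suc k" 0] by auto
    have "cis (2 * pi * (real (Suc k) * \<theta>)) ^ m = cis (2 * pi * \<theta>) ^ (Suc k * m)"
      unfolding Complex.DeMoivre of_nat_mult by (simp only: mult_ac)
    moreover have "Suc k * m > k" using m(1) by (cases m) auto
    ultimately show ?thesis using m(2) by (metis cis_zero)
  qed
  then obtain N where N: "\<And>k. N k > k" "\<And>k. norm (cis (2 * pi * \<theta>) ^ N k - 1) < 1 / Suc k"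
    by metis
  have "(\<lambda>k. cis (2 * pi * \<theta>) ^ N k - 1) \<longlonglongrightarrow> 0"
  proof (rule Lim_null_comparison[OF _ LIMSEQ_inverse_real_of_nat])
    show "\<forall>\<^sub>F k in sequentially. norm (cis (2 * pi * \<theta>) ^ N k - 1) \<le> inverse (real (Suc k))"
      unfolding inverse_eq_divide using N(2) by (intro always_eventually allI less_imp_le)
  qed
  then have "(\<lambda>k. cis (2 * pi * \<theta>) ^ N k) \<longlonglongrightarrow> 1" by (rule LIM_zero_cancel)
  with N(1) show ?thesis by blast
qed

section \<open>The group acting on the cubic surface\<close>

definition hol3 :: "(complex \<Rightarrow> complex \<times> complex \<times> complex) \<Rightarrow> complex set \<Rightarrow> bool" where
  "hol3 \<phi> T \<longleftrightarrow> (\<lambda>t. fst (\<phi> t)) holomorphic_on T \<and> (\<lambda>t. fst (snd (\<phi> t))) holomorphic_on T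
     \<and> (\<lambda>t. snd (snd (\<phi> t))) holomorphic_on T"

lemma hol3_cong: "(\<And>t. t \<in> T \<Longrightarrow> \<phi> t = \<psi> t) \<Longrightarrow> hol3 \<phi> T \<longleftrightarrow> hol3 \<psi> T"
  by (simp add: hol3_def cong: holomorphic_cong)

locale cubic_surface = fixes A B C D :: complex
begin

abbreviation "S \<equiv> surf A B C D"
abbreviation "\<Gamma> \<equiv> grp A B C D"

text \<open>Group elements are meaningful only on the surface, which may be singular, so their
  holomorphy is tested on holomorphic curves inside it. This form is visibly stable under
  composition.\<close>

definition regular_bij :: "(complex \<times> complex \<times> complex \<Rightarrow> complex \<times> complex \<times> complex) \<Rightarrow> bool" where
  "regular_bij f \<longleftrightarrow> f \<in> Bij S \<and> continuous_on S f
     \<and> (\<forall>\<phi> T. hol3 \<phi> T \<and> \<phi> ` T \<subseteq> S \<longrightarrow> hol3 (f \<circ> \<phi>) T)"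

lemma regular_bij_restrict:
  assumes "restrict f S \<in> Bij S" "continuous_on S f" "\<And>\<phi> T. hol3 \<phi> T \<Longrightarrow> hol3 (f \<circ> \<phi>) T"
  shows "regular_bij (restrict f S)"
  unfolding regular_bij_def
proof (intro conjI allI impI)
  show "continuous_on S (restrict f S)"
    using assms(2) by (simp cong: continuous_on_cong)
  fix \<phi> T assume *: "hol3 \<phi> T \<and> \<phi> ` T \<subseteq> S"
  have "hol3 (restrict f S \<circ> \<phi>) T \<longleftrightarrow> hol3 (f \<circ> \<phi>) T"
    by (rule hol3_cong) (use * in auto)
  then show "hol3 (restrict f S \<circ> \<phi>) T" using assms(3) * by blast
qed (rule assms)

lemma hol3_invol:
  assumes "hol3 \<phi> T"
  shows "hol3 (s_x A \<circ> \<phi>) T" "hol3 (s_y B \<circ> \<phi>) T" "hol3 (s_z C \<circ> \<phi>) T"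
  using assms by (auto simp: hol3_def s_x_def s_y_def s_z_def split_beta intro!: holomorphic_intros)

lemma hol3_invol2:
  assumes "hol3 \<phi> T"
  shows "hol3 (s_x A \<circ> s_y B \<circ> \<phi>) T" "hol3 (s_x A \<circ> s_z C \<circ> \<phi>) T"
    "hol3 (s_y B \<circ> s_x A \<circ> \<phi>) T" "hol3 (s_y B \<circ> s_z C \<circ> \<phi>) T"
    "hol3 (s_z C \<circ> s_x A \<circ> \<phi>) T" "hol3 (s_z C \<circ> s_y B \<circ> \<phi>) T"
  using assms by (simp_all only: comp_assoc hol3_invol)

lemma cont_invol:
  "continuous_on X (s_x A)" "continuous_on X (s_y B)" "continuous_on X (s_z C)"
  by (auto simp: s_x_def s_y_def s_z_def split_beta intro!: continuous_intros)

lemma cont_invol2: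
  "continuous_on X (s_x A \<circ> s_y B)" "continuous_on X (s_x A \<circ> s_z C)"
  "continuous_on X (s_y B \<circ> s_x A)" "continuous_on X (s_y B \<circ> s_z C)"
  "continuous_on X (s_z C \<circ> s_x A)" "continuous_on X (s_z C \<circ> s_y B)"
  by (intro continuous_on_compose cont_invol)+

lemma Bij_invol2:
  "restrict (s_x A \<circ> s_y B) S \<in> Bij S" "restrict (s_x A \<circ> s_z C) S \<in> Bij S"
  "restrict (s_y B \<circ> s_x A) S \<in> Bij S" "restrict (s_y B \<circ> s_z C) S \<in> Bij S"
  "restrict (s_z C \<circ> s_x A) S \<in> Bij S" "restrict (s_z C \<circ> s_y B) S \<in> Bij S"
  by (rule restrict_comp_Bij; simp add: s_x_surf s_y_surf s_z_surf)+

lemma regular_bij_invol2: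
  "regular_bij (restrict (s_x A \<circ> s_y B) S)" "regular_bij (restrict (s_x A \<circ> s_z C) S)"
  "regular_bij (restrict (s_y B \<circ> s_x A) S)" "regular_bij (restrict (s_y B \<circ> s_z C) S)"
  "regular_bij (restrict (s_z C \<circ> s_x A) S)" "regular_bij (restrict (s_z C \<circ> s_y B) S)"
  by (intro regular_bij_restrict Bij_invol2 cont_invol2; rule hol3_invol2; assumption)+

lemma inv_restrict_comp:
  assumes "\<And>p. p \<in> S \<Longrightarrow> f p \<in> S" "\<And>p. p \<in> S \<Longrightarrow> g p \<in> S"
    and "\<And>p. f (f p) = p" "\<And>p. g (g p) = p"
  shows "inv\<^bsub>BijGroup S\<^esub> (restrict (f \<circ> g) S) = restrict (g \<circ> f) S"
proof -
  have Bij: "restrict (f \<circ> g) S \<in> Bij S" by (rule restrict_comp_Bij) (use assms in auto)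
  have "inv_into S (restrict (f \<circ> g) S) p = g (f p)" if "p \<in> S" for p
    by (rule inv_into_f_eq) (use Bij assms that in \<open>auto simp: Bij_def bij_betw_def\<close>)
  then show ?thesis unfolding inv_BijGroup[OF Bij] by (auto intro!: restrict_ext)
qed

lemma gens_eq:
  "g_x A B C = s_z C \<circ> s_y B" "g_y A B C = s_x A \<circ> s_z C" "g_z A B C = s_y B \<circ> s_x A"
  by (simp_all add: g_x_def g_y_def g_z_def)

lemma inv_gens:
  "inv\<^bsub>BijGroup S\<^esub> (restrict (g_x A B C) S) = restrict (s_y B \<circ> s_z C) S"
  "inv\<^bsub>BijGroup S\<^esub> (restrict (g_y A B C) S) = restrict (s_z C \<circ> s_x A) S"
  "inv\<^bsub>BijGroup S\<^esub> (restrict (g_z A B C) S) = restrict (s_x A \<circ> s_y B) S"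
  unfolding gens_eq by (rule inv_restrict_comp; simp add: s_x_surf s_y_surf s_z_surf)+

lemma grp_generators:
  "restrict (s_z C \<circ> s_y B) S \<in> \<Gamma>" "restrict (s_x A \<circ> s_z C) S \<in> \<Gamma>" "restrict (s_y B \<circ> s_x A) S \<in> \<Gamma>"
  "restrict (s_y B \<circ> s_z C) S \<in> \<Gamma>" "restrict (s_z C \<circ> s_x A) S \<in> \<Gamma>" "restrict (s_x A \<circ> s_y B) S \<in> \<Gamma>"
  unfolding grp_def inv_gens[symmetric] gens_eq[symmetric]
  by (auto intro: generate.incl generate.inv)

lemma grp_subset: "\<Gamma> \<subseteq> Bij S"
  using group.generate_incl[OF group_BijGroup, of _ S] gens_Bij
  by (auto simp: grp_def BijGroup_def)

lemma grp_compose: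
  assumes "\<gamma> \<in> \<Gamma>" "\<delta> \<in> \<Gamma>"
  shows "compose S \<gamma> \<delta> \<in> \<Gamma>"
proof -
  have "\<gamma> \<otimes>\<^bsub>BijGroup S\<^esub> \<delta> \<in> \<Gamma>"
    using assms unfolding grp_def by (rule generate.eng)
  then show ?thesis using assms grp_subset by (simp add: BijGroup_def subset_iff)
qed

lemma regular_bij_grp:
  assumes "\<gamma> \<in> \<Gamma>"
  shows "regular_bij \<gamma>"
  using assms[unfolded grp_def]
proof (induction rule: generate.induct)
  case one
  have "regular_bij (restrict (\<lambda>p. p) S)"
    by (rule regular_bij_restrict)
      (auto simp: comp_def intro!: continuous_intros id_Bij[unfolded restrict_def, folded restrict_def])
  then show ?case by (simp add: BijGroup_def restrict_def)
next
  case (incl h)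
  then show ?case using regular_bij_invol2 by (auto simp: gens_eq)
next
  case (inv h)
  then have "inv\<^bsub>BijGroup S\<^esub> h \<in> {restrict (s_y B \<circ> s_z C) S, restrict (s_z C \<circ> s_x A) S, restrict (s_x A \<circ> s_y B) S}"
    using inv_gens by blast
  then show ?case by (elim insertE emptyE) (simp_all only: regular_bij_invol2)
next
  case (eng \<gamma> \<delta>)
  have Bij: "\<gamma> \<in> Bij S" "\<delta> \<in> Bij S" using eng.IH by (auto simp: regular_bij_def)
  then have maps: "\<delta> p \<in> S" if "p \<in> S" for p using that by (auto simp: Bij_def bij_betw_def)
  have eq: "\<gamma> \<otimes>\<^bsub>BijGroup S\<^esub> \<delta> = compose S \<gamma> \<delta>" using Bij by (simp add: BijGroup_def)
  have cont: "continuous_on S (\<gamma> \<circ> \<delta>)"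
  proof (rule continuous_on_compose)
    show "continuous_on S \<delta>" using eng.IH by (simp add: regular_bij_def)
    show "continuous_on (\<delta> ` S) \<gamma>"
      using eng.IH(1) maps unfolding regular_bij_def by (metis continuous_on_subset image_subsetI)
  qed
  have "hol3 (compose S \<gamma> \<delta> \<circ> \<phi>) T" if "hol3 \<phi> T" "\<phi> ` T \<subseteq> S" for \<phi> T
  proof -
    have "hol3 (\<delta> \<circ> \<phi>) T" using eng.IH(2) that by (auto simp: regular_bij_def)
    moreover have "(\<delta> \<circ> \<phi>) ` T \<subseteq> S"
      unfolding image_comp[symmetric] using that(2) maps by blast
    ultimately have "hol3 (\<gamma> \<circ> (\<delta> \<circ> \<phi>)) T" using eng.IH(1) unfolding regular_bij_def by blast
    moreover have "hol3 (compose S \<gamma> \<delta> \<circ> \<phi>) T \<longleftrightarrow> hol3 (\<gamma> \<circ> (\<delta> \<circ> \<phi>)) T"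
      by (rule hol3_cong) (use that in \<open>auto simp: compose_def\<close>)
    ultimately show ?thesis by blast
  qed
  moreover have "continuous_on S (compose S \<gamma> \<delta>)"
    using cont by (auto simp: compose_def cong: continuous_on_cong)
  ultimately show ?case
    unfolding eq regular_bij_def using compose_Bij[OF Bij] by blast
qed

lemma grp_maps: "\<gamma> \<in> \<Gamma> \<Longrightarrow> p \<in> S \<Longrightarrow> \<gamma> p \<in> S"
  using regular_bij_grp by (fastforce simp: regular_bij_def Bij_def bij_betw_def)

lemma grp_continuous: "\<gamma> \<in> \<Gamma> \<Longrightarrow> continuous_on S \<gamma>"
  using regular_bij_grp by (simp add: regular_bij_def)

lemma grp_hol3: "\<gamma> \<in> \<Gamma> \<Longrightarrow> hol3 \<phi> T \<Longrightarrow> \<phi> ` T \<subseteq> S \<Longrightarrow> hol3 (\<gamma> \<circ> \<phi>) T"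
  using regular_bij_grp unfolding regular_bij_def by blast

lemma grp_inverse:
  assumes "\<gamma> \<in> \<Gamma>"
  obtains \<delta> where "\<delta> \<in> \<Gamma>" "\<And>p. p \<in> S \<Longrightarrow> \<delta> (\<gamma> p) = p" "\<And>p. p \<in> S \<Longrightarrow> \<gamma> (\<delta> p) = p"
proof
  have Bij: "\<gamma> \<in> Bij S" using assms grp_subset by blast
  have "inv\<^bsub>BijGroup S\<^esub> \<gamma> \<in> \<Gamma>"
    using group.generate_m_inv_closed[OF group_BijGroup, of _ S \<gamma>] gens_Bij assms
    by (auto simp: grp_def BijGroup_def)
  then show "restrict (inv_into S \<gamma>) S \<in> \<Gamma>" using inv_BijGroup[OF Bij] by simp
  fix p assume p: "p \<in> S"
  show "restrict (inv_into S \<gamma>) S (\<gamma> p) = p"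
    using Bij p grp_maps[OF assms p] by (auto simp: Bij_def bij_betw_def)
  show "\<gamma> (restrict (inv_into S \<gamma>) S p) = p"
    using Bij p by (auto simp: Bij_def bij_betw_def f_inv_into_f)
qed

text \<open>Group elements are extensional, so the condition \<open>p \<in> S\<close> keeps outside
  points from being related to \<open>undefined\<close> and makes this an equivalence relation on
  the surface.\<close>

definition orbit_equiv :: "complex \<times> complex \<times> complex \<Rightarrow> complex \<times> complex \<times> complex \<Rightarrow> bool"
    (infix \<open>\<asymp>\<close> 50) where
  "p \<asymp> q \<longleftrightarrow> p \<in> S \<and> (\<exists>\<gamma>\<in>\<Gamma>. q = \<gamma> p)"

lemma orbit_equivI: "\<gamma> \<in> \<Gamma> \<Longrightarrow> p \<in> S \<Longrightarrow> p \<asymp> \<gamma> p"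
  by (auto simp: orbit_equiv_def)

lemma orbit_equiv_sym: "p \<asymp> q \<Longrightarrow> q \<asymp> p"
  unfolding orbit_equiv_def by (metis grp_inverse grp_maps)

lemma orbit_equiv_trans [trans]: "p \<asymp> q \<Longrightarrow> q \<asymp> r \<Longrightarrow> p \<asymp> r"
  unfolding orbit_equiv_def by (metis grp_compose compose_eq)

lemma orbit_equiv_refl: "p \<in> S \<Longrightarrow> p \<asymp> p"
  by (metis orbit_equiv_def grp_generators(1) orbit_equiv_sym orbit_equiv_trans)

lemma orbit_equiv_g_x: "p \<in> S \<Longrightarrow> p \<asymp> s_z C (s_y B p)"
  using orbit_equivI[OF grp_generators(1)] by (simp del: split_paired_All split_paired_all)

lemma orbit_equiv_g_y_inv: "p \<in> S \<Longrightarrow> p \<asymp> s_z C (s_x A p)"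
  using orbit_equivI[OF grp_generators(5)] by (simp del: split_paired_All split_paired_all)

section \<open>Invariance of the Fatou and Julia sets, and the Baire argument\<close>

lemma openin_fatou: "openin (top_of_set S) (fatou A B C D)"
proof (subst openin_subopen, intro ballI)
  fix p assume "p \<in> fatou A B C D"
  then obtain U where U: "openin (top_of_set S) U" "p \<in> U" "normal_family_on S \<Gamma> U"
    by (auto simp: fatou_def)
  then have "U \<subseteq> fatou A B C D"
    using openin_imp_subset by (fastforce simp: fatou_def)
  then show "\<exists>T. openin (top_of_set S) T \<and> p \<in> T \<and> T \<subseteq> fatou A B C D" using U by blast
qed

lemma closed_julia: "closed (julia A B C D)"
proof -
  have "closedin (top_of_set S) (julia A B C D)"
    unfolding julia_def using closedin_diff[OF closedin_topspace openin_fatou] by simp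
  then show ?thesis using closed_surf closedin_closed_trans by blast
qed

text \<open>Composing on the right with \<open>\<gamma>\<close> stays in the group, so a sequence
  \<open>f\<close> near \<open>\<gamma> p\<close> behaves like the sequence \<open>h\<close> near
  \<open>p\<close>; compact sets are carried over by the inverse \<open>\<delta>\<close>.\<close>

lemma fatou_invariant:
  assumes p: "p \<in> fatou A B C D" and \<gamma>: "\<gamma> \<in> \<Gamma>"
  shows "\<gamma> p \<in> fatou A B C D"
proof -
  obtain U where U: "openin (top_of_set S) U" "p \<in> U" "normal_family_on S \<Gamma> U"
    using p by (auto simp: fatou_def)
  have US: "U \<subseteq> S" using U openin_imp_subset by blast
  obtain \<delta> where \<delta>: "\<delta> \<in> \<Gamma>" "\<And>p. p \<in> S \<Longrightarrow> \<delta> (\<gamma> p) = p" "\<And>p. p \<in> S \<Longrightarrow> \<gamma> (\<delta> p) = p"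
    using grp_inverse[OF \<gamma>] by blast
  let ?U = "S \<inter> \<delta> -` U"
  have op: "openin (top_of_set S) ?U"
    using continuous_openin_preimage[OF grp_continuous[OF \<delta>(1)], of S U] U(1) grp_maps[OF \<delta>(1)] by blast
  have "normal_family_on S \<Gamma> ?U"
    unfolding normal_family_on_def
  proof (intro allI impI)
    fix f :: "nat \<Rightarrow> _" assume f: "\<forall>n. f n \<in> \<Gamma>"
    define h where "h n = compose S (f n) \<gamma>" for n
    have h: "h n p = f n (\<gamma> p)" if "p \<in> S" for n p using that by (simp add: h_def compose_eq)
    have "\<forall>n. h n \<in> \<Gamma>" using f \<gamma> grp_compose by (simp add: h_def)
    then obtain r :: "nat \<Rightarrow> nat" where r: "strict_mono r" "converges_loc_unif (h \<circ> r) U \<or> converges_to_infinity S (h \<circ> r) U"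
      using U(3) unfolding normal_family_on_def by blast
    have comp: "compact (\<delta> ` V)" "\<delta> ` V \<subseteq> U" "V \<subseteq> S" if "compact V" "V \<subseteq> ?U" for V
      using that \<delta>(1) by (auto intro!: compact_continuous_image elim!: continuous_on_subset[OF grp_continuous])
    have fh: "f n q = h n (\<delta> q)" if "q \<in> S" for n q using that h[of "\<delta> q" n] \<delta> grp_maps by simp
    have "converges_loc_unif (f \<circ> r) ?U" if c: "converges_loc_unif (h \<circ> r) U"
    proof -
      obtain l where l: "\<And>V. compact V \<Longrightarrow> V \<subseteq> U \<Longrightarrow> uniform_limit V (h \<circ> r) l sequentially"
        using c unfolding converges_loc_unif_def by blast
      have "uniform_limit V (f \<circ> r) (l \<circ> \<delta>) sequentially" if V: "compact V" "V \<subseteq> ?U" for V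
      proof (rule uniform_limitI)
        fix e :: real assume "e > 0"
        from uniform_limitD[OF l[OF comp(1,2)[OF V]] this]
        show "\<forall>\<^sub>F n in sequentially. \<forall>x\<in>V. dist ((f \<circ> r) n x) ((l \<circ> \<delta>) x) < e"
          by eventually_elim (use comp(3)[OF V] fh in auto)
      qed
      then show ?thesis unfolding converges_loc_unif_def by blast
    qed
    moreover have "converges_to_infinity S (f \<circ> r) ?U" if c: "converges_to_infinity S (h \<circ> r) U"
      unfolding converges_to_infinity_def
    proof (intro allI impI)
      fix V K assume VK: "compact V \<and> V \<subseteq> ?U \<and> compact K \<and> K \<subseteq> S"
      then have V: "compact V" "V \<subseteq> ?U" by auto
      have "(f \<circ> r) i ` V = (h \<circ> r) i ` \<delta> ` V" for i
        unfolding image_image using comp(3)[OF V] fh by (intro image_cong) auto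
      then show "finite {i. (f \<circ> r) i ` V \<inter> K \<noteq> {}}"
        using c VK comp[OF V] unfolding converges_to_infinity_def by simp
    qed
    ultimately show "\<exists>r. strict_mono r \<and> (converges_loc_unif (f \<circ> r) ?U \<or> converges_to_infinity S (f \<circ> r) ?U)"
      using r by blast
  qed
  moreover have "\<gamma> p \<in> ?U" using \<delta>(2)[of p] U(2) US grp_maps[OF \<gamma>, of p] by auto
  ultimately show ?thesis using op unfolding fatou_def by blast
qed

lemma julia_invariant:
  assumes "p \<asymp> q" "p \<in> julia A B C D"
  shows "q \<in> julia A B C D"
proof -
  have "q \<in> S" using assms(1) grp_maps unfolding orbit_equiv_def by blast
  moreover have "q \<notin> fatou A B C D"
    using orbit_equiv_sym[OF assms(1)] assms(2) fatou_invariant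
    unfolding orbit_equiv_def julia_def by blast
  ultimately show ?thesis by (simp add: julia_def)
qed

lemma orbit_equiv_surf: "p \<asymp> q \<Longrightarrow> p \<in> S" "p \<asymp> q \<Longrightarrow> q \<in> S"
  unfolding orbit_equiv_def using grp_maps by blast+

lemma dense_orbit_if_transitive:
  assumes ne: "julia A B C D \<noteq> {}"
    and trans: "\<And>U V. open U \<Longrightarrow> open V \<Longrightarrow> U \<inter> julia A B C D \<noteq> {} \<Longrightarrow> V \<inter> julia A B C D \<noteq> {} \<Longrightarrow>
      \<exists>p q. p \<in> U \<inter> julia A B C D \<and> q \<in> V \<and> p \<asymp> q"
  shows "\<exists>p \<in> julia A B C D. closure (grp_orbit A B C D p) = julia A B C D"
proof -
  let ?J = "julia A B C D"
  obtain \<B> :: "(complex \<times> complex \<times> complex) set set" where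
    \<B>: "countable \<B>" "\<And>X. X \<in> \<B> \<Longrightarrow> open X" "\<And>T. open T \<Longrightarrow> \<exists>\<U>\<subseteq>\<B>. T = \<Union>\<U>"
    using univ_second_countable by metis
  define \<B>' where "\<B>' = {X \<in> \<B>. X \<inter> ?J \<noteq> {}}"
  \<comment> \<open>The Julia points whose orbit enters \<open>X\<close>. A point in all of these
    sets, for the basic \<open>X\<close> meeting the Julia set, has the dense orbit.\<close>
  define O' where "O' X = {p \<in> ?J. \<exists>q\<in>X. p \<asymp> q}" for X
  have "?J \<subseteq> closure (\<Inter>(O' ` \<B>'))"
  proof (rule Baire[OF closed_julia])
    show "countable (O' ` \<B>')" using \<B>(1) by (simp add: \<B>'_def)
    fix T assume "T \<in> O' ` \<B>'"
    then obtain X where X: "X \<in> \<B>" "X \<inter> ?J \<noteq> {}" "T = O' X" by (auto simp: \<B>'_def)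
    have T: "T = ?J \<inter> (\<Union>\<gamma>\<in>\<Gamma>. S \<inter> \<gamma> -` X)"
      by (auto simp: X O'_def orbit_equiv_def julia_def)
    have "openin (top_of_set S) (S \<inter> \<gamma> -` X)" if "\<gamma> \<in> \<Gamma>" for \<gamma>
      using continuous_openin_preimage_gen[OF grp_continuous[OF that]] \<B>(2)[OF X(1)] by blast
    then have "openin (top_of_set S) (\<Union>\<gamma>\<in>\<Gamma>. S \<inter> \<gamma> -` X)" by blast
    then obtain W where W: "open W" "(\<Union>\<gamma>\<in>\<Gamma>. S \<inter> \<gamma> -` X) = S \<inter> W"
      unfolding openin_open by blast
    have "T = ?J \<inter> W" unfolding T W(2) by (auto simp: julia_def)
    with W(1) have "openin (top_of_set ?J) T" by blast
    moreover have "?J \<subseteq> closure T"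
    proof
      fix p assume p: "p \<in> ?J"
      show "p \<in> closure T"
        unfolding closure_iff_nhds_not_empty
      proof (intro allI impI)
        fix Y W assume "W \<subseteq> Y" "open W" "p \<in> W"
        then show "T \<inter> Y \<noteq> {}"
          using trans[OF \<open>open W\<close> \<B>(2)[OF X(1)]] p X(2) by (auto simp: X(3) O'_def)
      qed
    qed
    ultimately show "openin (top_of_set ?J) T \<and> ?J \<subseteq> closure T" by blast
  qed
  moreover obtain p0 where "p0 \<in> ?J" using ne by blast
  ultimately have "closure (\<Inter>(O' ` \<B>') \<inter> ?J) \<noteq> {}"
  proof -
    \<comment> \<open>An empty family would have intersection \<open>UNIV\<close>, and the Baire
      point could then lie outside the Julia set.\<close>
    have "\<B>' \<noteq> {}"
    proof -
      obtain \<U> where "\<U> \<subseteq> \<B>" "UNIV = \<Union>\<U>" using \<B>(3)[OF open_UNIV] by blast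
      moreover from this obtain X where "X \<in> \<U>" "p0 \<in> X" by (metis UNIV_I UnionE)
      ultimately have "X \<in> \<B>'" using \<open>p0 \<in> ?J\<close> by (auto simp: \<B>'_def)
      then show ?thesis by blast
    qed
    then have "\<Inter>(O' ` \<B>') \<subseteq> ?J" by (auto simp: O'_def)
    then show ?thesis using \<open>p0 \<in> ?J\<close> \<open>?J \<subseteq> closure (\<Inter>(O' ` \<B>'))\<close> by (auto simp: Int_absorb2)
  qed
  then obtain p where p: "p \<in> ?J" "\<And>X. X \<in> \<B>' \<Longrightarrow> p \<in> O' X" by fastforce
  have sub: "grp_orbit A B C D p \<subseteq> ?J"
  proof -
    have "\<gamma> p \<in> ?J" if "\<gamma> \<in> \<Gamma>" for \<gamma>
      using julia_invariant[OF orbit_equivI[OF that]] p(1) unfolding julia_def by blast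
    then show ?thesis unfolding grp_orbit_def by blast
  qed
  have "?J \<subseteq> closure (grp_orbit A B C D p)"
  proof
    fix q assume q: "q \<in> ?J"
    show "q \<in> closure (grp_orbit A B C D p)"
      unfolding closure_iff_nhds_not_empty
    proof (intro allI impI)
      fix Y W assume W: "W \<subseteq> Y" "open W" "q \<in> W"
      then obtain X where X: "X \<in> \<B>" "q \<in> X" "X \<subseteq> W" using \<B>(3)[OF W(2)] by blast
      then have "p \<in> O' X" using p(2) q by (auto simp: \<B>'_def)
      then show "grp_orbit A B C D p \<inter> Y \<noteq> {}"
        using X W by (auto simp: O'_def orbit_equiv_def grp_orbit_def)
    qed
  qed
  then have "closure (grp_orbit A B C D p) = ?J"
    using closure_minimal[OF sub closed_julia] by blast
  then show ?thesis using p(1) by blast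
qed

section \<open>Fibres of the first coordinate\<close>

lemma quadratic_branch_nonzero:
  fixes \<mu> :: complex
  assumes "\<mu> \<noteq> 0" "\<mu>^2 \<noteq> 1"
  shows "4 - (\<mu> + 1/\<mu>)^2 = - ((\<mu> - 1/\<mu>)^2)" "\<mu> - 1/\<mu> \<noteq> 0"
  using assms by (auto simp: field_simps power2_eq_square)

text \<open>\<open>cY\<close> and \<open>cZ\<close> solve the linear system 2y + xz = B, 2z + xy =
  C, the vanishing of both partial derivatives of the conic; its determinant is
  \<open>4 - x^2\<close>.\<close>

definition cY :: "complex \<Rightarrow> complex" where "cY x = (2*B - x*C) / (4 - x^2)"
definition cZ :: "complex \<Rightarrow> complex" where "cZ x = (2*C - x*B) / (4 - x^2)"
text \<open>What remains of the constant term at the centre, divided by \<open>4 - x^2\<close>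
  because the quadratic form in eigencoordinates is
  \<open>(4 - x^2) * \<alpha> * \<beta>\<close>.\<close>

definition \<kappa> :: "complex \<Rightarrow> complex" where
  "\<kappa> x = (D + A*x - x^2 + (B^2 + C^2 - x*B*C) / (4 - x^2)) / (4 - x^2)"

definition trc :: "complex \<Rightarrow> complex" where "trc \<mu> = - (\<mu> + 1/\<mu>)"

text \<open>The fibre over \<open>x\<close> is the conic with centre \<open>(cY x, cZ x)\<close>; in the eigencoordinates
  \<open>\<alpha>, \<beta>\<close> of the affine map induced by \<open>g\<^sub>x\<close> it reads \<open>\<alpha> \<beta> = \<kappa> x\<close>. When \<open>\<kappa> x = 0\<close>, division by
  zero makes \<open>chart \<mu> 0\<close> the centre and \<open>chart \<mu>\<close> the line \<open>\<beta> = 0\<close>.\<close>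

definition chart :: "complex \<Rightarrow> complex \<Rightarrow> complex \<times> complex \<times> complex" where
  "chart \<mu> \<alpha> = (trc \<mu>, cY (trc \<mu>) + \<alpha> + \<kappa> (trc \<mu>) / \<alpha>,
      cZ (trc \<mu>) + \<alpha> * \<mu> + \<kappa> (trc \<mu>) / (\<alpha> * \<mu>))"

text \<open>The coefficient of \<open>(1, \<mu>)\<close> when the offset from the centre is written
  as a combination of \<open>(1, \<mu>)\<close> and \<open>(1, 1/\<mu>)\<close>. Exchanging
  \<open>\<mu>\<close> and \<open>1/\<mu>\<close> exchanges the two coefficients, so
  \<open>\<beta>\<close> is \<open>coordA (1/\<mu>)\<close>.\<close>

definition coordA :: "complex \<Rightarrow> complex \<times> complex \<times> complex \<Rightarrow> complex" where
  "coordA \<mu> p = ((snd (snd p) - cZ (fst p)) - (fst (snd p) - cY (fst p)) / \<mu>) / (\<mu> - 1/\<mu>)"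

lemma trc_discr:
  assumes "\<mu> \<noteq> 0" "\<mu>^2 \<noteq> 1"
  shows "4 - (trc \<mu>)^2 = - ((\<mu> - 1/\<mu>)^2)" "4 - (trc \<mu>)^2 \<noteq> 0"
  using quadratic_branch_nonzero[OF assms] by (simp_all only: trc_def power2_minus) simp

lemma center_eqs:
  assumes "4 - x^2 \<noteq> 0"
  shows "2 * cY x + x * cZ x = B" "2 * cZ x + x * cY x = C"
    "cY x ^2 + cZ x ^2 + x * cY x * cZ x - B * cY x - C * cZ x = - ((B^2 + C^2 - x*B*C) / (4 - x^2))"
proof -
  have c: "(4 - x^2) * cY x = 2*B - x*C" "(4 - x^2) * cZ x = 2*C - x*B"
    using assms by (simp_all add: cY_def cZ_def)
  have "(4 - x^2) * (2 * cY x + x * cZ x) = 2 * ((4 - x^2) * cY x) + x * ((4 - x^2) * cZ x)"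
    by (simp add: algebra_simps)
  also have "\<dots> = (4 - x^2) * B" unfolding c by (simp add: algebra_simps power2_eq_square)
  finally show 1: "2 * cY x + x * cZ x = B" using assms by simp
  have "(4 - x^2) * (2 * cZ x + x * cY x) = 2 * ((4 - x^2) * cZ x) + x * ((4 - x^2) * cY x)"
    by (simp add: algebra_simps)
  also have "\<dots> = (4 - x^2) * C" unfolding c by (simp add: algebra_simps power2_eq_square)
  finally show 2: "2 * cZ x + x * cY x = C" using assms by simp
  \<comment> \<open>Twice the quadratic form is the coordinates times its gradient (Euler), so after
    doubling the two centre equations apply.\<close>
  have "2 * (cY x ^2 + cZ x ^2 + x * cY x * cZ x - B * cY x - C * cZ x)
      = cY x * (2 * cY x + x * cZ x) + cZ x * (2 * cZ x + x * cY x) - 2 * B * cY x - 2 * C * cZ x"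
    by (simp add: algebra_simps power2_eq_square)
  also have "\<dots> = - (B * cY x + C * cZ x)" unfolding 1 2 by (simp add: algebra_simps)
  also have "\<dots> = 2 * (- ((B^2 + C^2 - x*B*C) / (4 - x^2)))"
    using assms by (simp add: cY_def cZ_def divide_simps) (simp add: algebra_simps power2_eq_square)
  finally show "cY x ^2 + cZ x ^2 + x * cY x * cZ x - B * cY x - C * cZ x = - ((B^2 + C^2 - x*B*C) / (4 - x^2))"
    by (simp only: mult_cancel_left) simp
qed

lemma surf_iff_conic:
  assumes x: "4 - x^2 \<noteq> 0"
  shows "(x, cY x + u, cZ x + v) \<in> S \<longleftrightarrow> u^2 + v^2 + x * u * v = (4 - x^2) * \<kappa> x"
proof -
  have "(cY x + u)^2 + (cZ x + v)^2 + x * (cY x + u) * (cZ x + v) - B * (cY x + u) - C * (cZ x + v)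
     = (cY x ^2 + cZ x ^2 + x * cY x * cZ x - B * cY x - C * cZ x)
       + u * (2 * cY x + x * cZ x - B) + v * (2 * cZ x + x * cY x - C) + (u^2 + v^2 + x * u * v)"
    by (simp add: algebra_simps power2_eq_square)
  also have "\<dots> = - ((B^2 + C^2 - x*B*C) / (4 - x^2)) + (u^2 + v^2 + x * u * v)"
    unfolding center_eqs(3)[OF x] center_eqs(1,2)[OF x] by simp
  finally have *: "(cY x + u)^2 + (cZ x + v)^2 + x * (cY x + u) * (cZ x + v) - B * (cY x + u) - C * (cZ x + v)
     = - ((B^2 + C^2 - x*B*C) / (4 - x^2)) + (u^2 + v^2 + x * u * v)" .
  have K: "(4 - x^2) * \<kappa> x = D + A*x - x^2 + (B^2 + C^2 - x*B*C) / (4 - x^2)"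
    using x by (simp add: \<kappa>_def)
  have "(x, cY x + u, cZ x + v) \<in> S \<longleftrightarrow> (cY x + u)^2 + (cZ x + v)^2 + x * (cY x + u) * (cZ x + v)
      - B * (cY x + u) - C * (cZ x + v) = D + A*x - x^2"
    unfolding surf_def by (auto simp: algebra_simps)
  also have "\<dots> \<longleftrightarrow> u^2 + v^2 + x * u * v = (4 - x^2) * \<kappa> x"
    unfolding * K by (auto simp: algebra_simps)
  finally show ?thesis .
qed

text \<open>The vectors \<open>(1, \<mu>)\<close> and \<open>(1, 1/\<mu>)\<close> are isotropic for
  the quadratic form of the fibre over \<open>trc \<mu>\<close>, so only the mixed term
  survives.\<close>

lemma conic_eigen:
  fixes \<mu> :: complex
  assumes "\<mu> \<noteq> 0" "\<mu>^2 \<noteq> 1"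
  shows "(a + b)^2 + (a * \<mu> + b / \<mu>)^2 + trc \<mu> * (a + b) * (a * \<mu> + b / \<mu>) = (4 - (trc \<mu>)^2) * (a * b)"
  using assms(1) unfolding trc_def by (simp add: field_simps power2_eq_square)

lemma chart_in_surf:
  assumes "\<mu> \<noteq> 0" "\<mu>^2 \<noteq> 1" "\<alpha> \<noteq> 0 \<or> \<kappa> (trc \<mu>) = 0"
  shows "chart \<mu> \<alpha> \<in> S"
proof -
  have "\<alpha> * (\<kappa> (trc \<mu>) / \<alpha>) = \<kappa> (trc \<mu>)" using assms by auto
  then show ?thesis
    using surf_iff_conic[OF trc_discr(2)[OF assms(1,2)], of "\<alpha> + \<kappa> (trc \<mu>) / \<alpha>" "\<alpha> * \<mu> + \<kappa> (trc \<mu>) / \<alpha> / \<mu>"]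
      conic_eigen[OF assms(1,2), of \<alpha> "\<kappa> (trc \<mu>) / \<alpha>"]
    by (simp add: chart_def add.assoc mult.commute)
qed

lemma
  assumes "\<mu> \<noteq> 0" "\<mu>^2 \<noteq> 1" "p \<in> S" "fst p = trc \<mu>"
  shows coordA_mult: "coordA \<mu> p * coordA (1/\<mu>) p = \<kappa> (trc \<mu>)"
    and chart_coordA: "coordA \<mu> p \<noteq> 0 \<or> coordA (1/\<mu>) p = 0 \<Longrightarrow> chart \<mu> (coordA \<mu> p) = p"
proof -
  obtain y z where p: "p = (trc \<mu>, y, z)" using assms(4) by (cases p) auto
  define u v where "u = y - cY (trc \<mu>)" and "v = z - cZ (trc \<mu>)"
  let ?a = "coordA \<mu> p" and ?b = "coordA (1/\<mu>) p"
  define a b where "a = ?a" and "b = ?b"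
  have ne: "\<mu> - 1/\<mu> \<noteq> 0" using quadratic_branch_nonzero[OF assms(1,2)] by blast
  have a: "a = (v - u/\<mu>) / (\<mu> - 1/\<mu>)" by (simp add: a_def coordA_def p u_def v_def)
  have b: "b = (u * \<mu> - v) / (\<mu> - 1/\<mu>)"
    using minus_divide_divide[of "u * \<mu> - v" "\<mu> - 1/\<mu>"] by (simp add: b_def coordA_def p u_def v_def)
  have u: "u = a + b" unfolding a b using ne assms(1) by (simp add: divide_simps) (simp add: algebra_simps)
  have v: "v = a * \<mu> + b / \<mu>" unfolding a b using ne assms(1) by (simp add: divide_simps) (simp add: algebra_simps)
  have "(4 - (trc \<mu>)^2) * (a * b) = (4 - (trc \<mu>)^2) * \<kappa> (trc \<mu>)"
    using surf_iff_conic[OF trc_discr(2)[OF assms(1,2)], of u v] assms(3) conic_eigen[OF assms(1,2), of a b]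
    by (simp only: p u_def[symmetric] v_def[symmetric] u[symmetric] v[symmetric]) (simp add: p u_def v_def)
  then have ab: "a * b = \<kappa> (trc \<mu>)"
    using trc_discr(2)[OF assms(1,2)] by (simp only: mult_cancel_left) simp
  then show "?a * ?b = \<kappa> (trc \<mu>)" by (simp add: a_def b_def)
  assume "?a \<noteq> 0 \<or> ?b = 0"
  then have nz: "a \<noteq> 0 \<or> b = 0" by (simp add: a_def b_def)
  have "\<kappa> (trc \<mu>) / a = b"
    using ab nz by (auto simp: field_simps)
  moreover have "\<kappa> (trc \<mu>) / (a * \<mu>) = b / \<mu>" using calculation by (metis divide_divide_eq_left)
  ultimately show "chart \<mu> ?a = p"
    unfolding chart_def a_def[symmetric] using u v by (simp add: p u_def v_def algebra_simps)
qed

text \<open>The offsets of y and z from the centre are the terms k = 0 and k = 1 of the sequence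
  \<open>a * \<mu>^k + b / \<mu>^k\<close>, which satisfies w(k+1) = - x w(k) - w(k-1). Each of the
  two involutions performs one step of this recursion, so \<open>g_x\<close> shifts it by
  two.\<close>

lemma g_x_chart:
  assumes "\<mu> \<noteq> 0" "\<mu>^2 \<noteq> 1"
  shows "s_z C (s_y B (chart \<mu> \<alpha>)) = chart \<mu> (\<alpha> * \<mu>^2)"
proof -
  define x a b where "x = trc \<mu>" and "a = \<alpha>" and "b = \<kappa> (trc \<mu>) / \<alpha>"
  have x: "x = - (\<mu> + 1/\<mu>)" by (simp add: x_def trc_def)
  have c: "B = 2 * cY x + x * cZ x" "C = 2 * cZ x + x * cY x"
    using center_eqs[OF trc_discr(2)[OF assms]] by (simp_all add: x_def)
  have 1: "chart \<mu> \<alpha> = (x, cY x + a + b, cZ x + a * \<mu> + b / \<mu>)"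
    by (simp add: chart_def x_def a_def b_def)
  have 2: "chart \<mu> (\<alpha> * \<mu>^2) = (x, cY x + a * \<mu>^2 + b / \<mu>^2, cZ x + a * \<mu>^3 + b / \<mu>^3)"
    by (simp add: chart_def x_def a_def b_def power2_eq_square power3_eq_cube mult.assoc)
  have y: "- (cY x + a + b) - x * (cZ x + a * \<mu> + b / \<mu>) + (2 * cY x + x * cZ x) = cY x + a * \<mu>^2 + b / \<mu>^2"
    using assms(1) unfolding x by (simp add: field_simps power2_eq_square)
  have z: "- (cZ x + a * \<mu> + b / \<mu>) - x * (cY x + a * \<mu>^2 + b / \<mu>^2) + (2 * cZ x + x * cY x) = cZ x + a * \<mu>^3 + b / \<mu>^3"
    using assms(1) unfolding x by (simp add: field_simps power2_eq_square power3_eq_cube)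
  have "s_y B (chart \<mu> \<alpha>) = (x, cY x + a * \<mu>^2 + b / \<mu>^2, cZ x + a * \<mu> + b / \<mu>)"
    unfolding 1 s_y_def prod.case using y by (simp only: c[symmetric])
  moreover have "s_z C \<dots> = chart \<mu> (\<alpha> * \<mu>^2)"
    unfolding 2 s_z_def prod.case using z by (simp only: c[symmetric])
  ultimately show ?thesis by simp
qed

lemma orbit_equiv_chart_power:
  assumes "\<mu> \<noteq> 0" "\<mu>^2 \<noteq> 1" "\<alpha> \<noteq> 0 \<or> \<kappa> (trc \<mu>) = 0"
  shows "chart \<mu> \<alpha> \<asymp> chart \<mu> (\<alpha> * (\<mu>^2)^n)"
proof (induction n)
  case 0
  then show ?case using chart_in_surf[OF assms] orbit_equiv_refl by simp
next
  case (Suc n)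
  have "chart \<mu> (\<alpha> * (\<mu>^2)^n) \<asymp> chart \<mu> (\<alpha> * (\<mu>^2)^n * \<mu>^2)"
    using orbit_equiv_g_x[OF chart_in_surf[of \<mu> "\<alpha> * (\<mu>^2)^n"]] assms g_x_chart[OF assms(1,2)] by auto
  with Suc show ?case by (metis orbit_equiv_trans mult.assoc power_Suc2)
qed

lemma orbit_equiv_chart_powi:
  assumes "\<mu> \<noteq> 0" "\<mu>^2 \<noteq> 1" "\<alpha> \<noteq> 0 \<or> \<kappa> (trc \<mu>) = 0"
  shows "chart \<mu> \<alpha> \<asymp> chart \<mu> (\<alpha> * (\<mu>^2) powi n)"
proof (cases "n \<ge> 0")
  case True
  then show ?thesis using orbit_equiv_chart_power[OF assms, of "nat n"] by (simp add: power_int_def)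
next
  case False
  \<comment> \<open>For negative \<open>n\<close> the forward power is applied to the target, and
    symmetry turns the relation around.\<close>
  have "chart \<mu> (\<alpha> * (\<mu>^2) powi n) \<asymp> chart \<mu> (\<alpha> * (\<mu>^2) powi n * (\<mu>^2)^(nat (-n)))"
    by (rule orbit_equiv_chart_power) (use assms in auto)
  also have "(\<alpha> * (\<mu>^2) powi n * (\<mu>^2)^(nat (-n))) = \<alpha>"
    using False assms(1) by (simp add: power_int_def power_inverse)
  finally show ?thesis by (rule orbit_equiv_sym)
qed

lemma tendsto_chart:
  assumes "(m \<longlongrightarrow> \<mu>) F" "(a \<longlongrightarrow> \<alpha>) F" "\<mu> \<noteq> 0" "\<mu>^2 \<noteq> 1" "\<alpha> \<noteq> 0"
  shows "((\<lambda>k. chart (m k) (a k)) \<longlongrightarrow> chart \<mu> \<alpha>) F"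
proof -
  have "4 - (- (\<mu> + 1/\<mu>))^2 \<noteq> 0" using trc_discr(2)[OF assms(3,4)] by (simp add: trc_def)
  then show ?thesis
    unfolding chart_def trc_def cY_def cZ_def \<kappa>_def
    by (intro tendsto_intros assms) (use assms in auto)
qed

lemma tendsto_coordA:
  assumes "(m \<longlongrightarrow> \<mu>) F" "(p \<longlongrightarrow> q) F" "\<mu> \<noteq> 0" "\<mu>^2 \<noteq> 1" "4 - (fst q)^2 \<noteq> 0"
  shows "((\<lambda>k. coordA (m k) (p k)) \<longlongrightarrow> coordA \<mu> q) F"
  unfolding coordA_def cY_def cZ_def
  by (intro tendsto_intros assms) (use assms quadratic_branch_nonzero[OF assms(3,4)] in auto)

section \<open>Generic fibres\<close>

text \<open>The irrational angle makes the rotation by \<open>\<mu>^2\<close> dense on circles;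
  \<open>\<kappa> \<noteq> 0\<close> makes the fibre a nondegenerate conic, on which
  \<open>\<alpha>\<close> never vanishes.\<close>

definition generic :: "complex \<Rightarrow> bool" where
  "generic \<mu> \<longleftrightarrow> (\<exists>\<theta>. \<theta> \<notin> \<rat> \<and> \<mu> = cis (2 * pi * \<theta>)) \<and> \<kappa> (trc \<mu>) \<noteq> 0"

lemma irrational_double: "\<theta> \<notin> \<rat> \<Longrightarrow> 2 * \<theta> \<notin> (\<rat> :: real set)"
proof
  assume "\<theta> \<notin> \<rat>" "2 * \<theta> \<in> \<rat>"
  then have "2 * \<theta> / 2 \<in> \<rat>" by (intro Rats_divide) auto
  then show False using \<open>\<theta> \<notin> \<rat>\<close> by simp
qed

lemma generic_sq:
  assumes "generic \<mu>"
  obtains \<theta> where "\<theta> \<notin> \<rat>" "\<mu>^2 = cis (2 * pi * \<theta>)"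
proof -
  obtain \<theta> where "\<theta> \<notin> \<rat>" "\<mu> = cis (2 * pi * \<theta>)" using assms by (auto simp: generic_def)
  then show thesis using that[of "2 * \<theta>"] irrational_double by (simp add: power2_eq_square cis_mult)
qed

lemma generic_simps:
  assumes "generic \<mu>"
  shows "norm \<mu> = 1" "\<mu> \<noteq> 0" "\<mu>^2 \<noteq> 1" "\<kappa> (trc \<mu>) \<noteq> 0"
proof -
  show "norm \<mu> = 1" "\<kappa> (trc \<mu>) \<noteq> 0" using assms by (auto simp: generic_def)
  then show "\<mu> \<noteq> 0" by auto
  show "\<mu>^2 \<noteq> 1"
  proof
    assume 1: "\<mu>^2 = 1"
    obtain \<theta> where \<theta>: "\<theta> \<notin> \<rat>" "\<mu>^2 = cis (2 * pi * \<theta>)" using generic_sq[OF assms] .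
    then obtain n :: int where "2 * pi * \<theta> = of_int n * 2 * pi"
      using 1 unfolding cis_conv_exp by (auto simp: exp_eq_1 mult_ac)
    then have "\<theta> = of_int n" by simp
    then show False using \<theta>(1) by simp
  qed
qed

text \<open>Clearing denominators, \<open>(4 - x^2)^2 * \<kappa> x\<close> is a quartic polynomial
  whose leading coefficient is 1 for every choice of the parameters.\<close>

lemma finite_degenerate: "finite {x. 4 - x^2 \<noteq> 0 \<and> \<kappa> x = 0}"
proof -
  define P where "P = [:4,0,-1:] * [:D, A, -1:] + [:B^2 + C^2, - (B*C):]"
  have "coeff P 4 = 1" by (simp add: P_def numeral_eq_Suc)
  then have "P \<noteq> 0" by auto
  then have "finite {x. poly P x = 0}" by (rule poly_roots_finite)
  moreover have "poly P x = 0" if "4 - x^2 \<noteq> 0" "\<kappa> x = 0" for x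
  proof -
    have "poly P x = (4 - x^2) * (D + A*x - x^2) + (B^2 + C^2 - x*B*C)"
      by (simp add: P_def algebra_simps power2_eq_square)
    also have "\<dots> = (4 - x^2)^2 * \<kappa> x"
    proof -
      have "(4 - x^2) * \<kappa> x = D + A*x - x^2 + (B^2 + C^2 - x*B*C) / (4 - x^2)"
        using that(1) by (simp add: \<kappa>_def)
      then have "(4 - x^2)^2 * \<kappa> x = (4 - x^2) * (D + A*x - x^2 + (B^2 + C^2 - x*B*C) / (4 - x^2))"
        by (metis power2_eq_square mult.assoc)
      then show ?thesis using that(1) by (simp add: distrib_left)
    qed
    finally show ?thesis using that(2) by simp
  qed
  ultimately show ?thesis by (auto elim: finite_subset[rotated])
qed

text \<open>Rational angles, degenerate fibres and \<open>F\<close> exclude only countably many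
  values of \<open>r = - 2 * cos (2 * pi * \<theta>)\<close>, and an interval is
  uncountable.\<close>

lemma generic_dense:
  assumes ab: "-2 \<le> a" "a < b" "b \<le> 2" and F: "finite F"
  shows "\<exists>\<mu> r. generic \<mu> \<and> trc \<mu> = of_real r \<and> a < r \<and> r < b \<and> trc \<mu> \<notin> F"
proof -
  define G where "G = F \<union> {x. 4 - x^2 \<noteq> 0 \<and> \<kappa> x = 0}"
  define Q where "Q = (\<lambda>q. -2 * cos (2 * pi * q)) ` \<rat> \<union> {r. complex_of_real r \<in> G}"
  have "finite G" using F finite_degenerate by (simp add: G_def)
  then have "finite {r. complex_of_real r \<in> G}"
    using finite_vimageI[of G complex_of_real] inj_of_real by (simp add: vimage_def)
  then have "countable Q" by (simp add: Q_def countable_rat countable_finite)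
  then have "\<not> {a<..<b} \<subseteq> Q" using ab(2) uncountable_open_interval countable_subset by blast
  then obtain r where "r \<in> {a<..<b}" "r \<notin> Q" by blast
  then have r: "a < r" "r < b" "r \<notin> Q" by auto
  define \<theta> where "\<theta> = arccos (- r/2) / (2 * pi)"
  have cos: "cos (2 * pi * \<theta>) = - r/2" using r ab by (simp add: \<theta>_def cos_arccos)
  then have "\<theta> \<notin> \<rat>" using r(3) by (force simp: Q_def)
  moreover have tr: "trc (cis (2 * pi * \<theta>)) = of_real r"
    using cos by (simp add: trc_def complex_eq_iff flip: inverse_eq_divide)
  moreover have "4 - (complex_of_real r)^2 \<noteq> 0"
  proof -
    have "\<bar>r\<bar> < 2" using r ab by linarith
    then have "r^2 < 4" using abs_square_less_1[of "r/2"] by (simp add: power_divide)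
    then have "4 - r^2 \<noteq> 0" by simp
    then show ?thesis by (metis of_real_diff of_real_eq_0_iff of_real_numeral of_real_power)
  qed
  ultimately show ?thesis
    using r by (intro exI[of _ "cis (2 * pi * \<theta>)"] exI[of _ r]) (auto simp: generic_def Q_def G_def)
qed

section \<open>Moving along a generic fibre\<close>

text \<open>The involution \<open>s_x\<close> takes first coordinate \<open>x\<close> to
  \<open>x'\<close> exactly when the product yz equals \<open>s\<close>. Then
  \<open>x^2 + x*s - A*x = - x*x'\<close>, and multiplying the surface equation by
  \<open>y^2\<close> eliminates z and leaves this quartic.\<close>

lemma surf_from_trace_pair:
  assumes "y \<noteq> 0" and s: "s = A - x - x'"
    and root: "poly [:s^2, - (C * s), - (D + x*x'), -B, 1:] y = 0"
  shows "(x, y, s / y) \<in> S"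
proof -
  define z where "z = s / y"
  have sz: "s = y * z" using assms(1) by (simp add: z_def)
  have A: "A = x + x' + y * z" using s sz by (simp add: algebra_simps)
  then have "y^2 * (x^2 + y^2 + z^2 + x*y*z - A*x - B*y - C*z - D) = poly [:s^2, - (C * s), - (D + x*x'), -B, 1:] y"
    unfolding sz by (simp add: A algebra_simps power2_eq_square)
  then have "x^2 + y^2 + z^2 + x*y*z - A*x - B*y - C*z - D = 0" using root assms(1) by simp
  then show ?thesis unfolding surf_def z_def[symmetric] by (simp add: algebra_simps)
qed

text \<open>The quotient \<open>w / \<alpha>\<close> is approximated in polar form: the power
  \<open>j\<close> takes care of its argument, and \<open>exp (2l/Q)\<close> with l the floor of
  \<open>Q * ln \<rho> / 2\<close> of its modulus. As \<open>j\<close> is independent of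
  \<open>Q\<close> and every large \<open>Q\<close> works, two open sets can later share one
  \<open>Q\<close>.\<close>

lemma generic_rotation_approx:
  assumes \<mu>: "generic \<mu>" and W: "open W" "chart \<mu> w \<in> W" and nz: "w \<noteq> 0" "\<alpha> \<noteq> 0"
  shows "\<exists>j. \<forall>\<^sub>F Q in sequentially. \<exists>l. chart \<mu> (\<alpha> * (of_real (exp (2 * of_int l / real Q)) * (\<mu>^2)^j)) \<in> W"
proof -
  define v where "v = w / \<alpha>"
  have v: "v \<noteq> 0" using nz by (simp add: v_def)
  have "((\<lambda>u. chart \<mu> (\<alpha> * u)) \<longlongrightarrow> chart \<mu> (\<alpha> * v)) (nhds v)"
    using nz v generic_simps[OF \<mu>] by (intro tendsto_chart tendsto_intros) (auto simp: filterlim_ident)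
  moreover have "chart \<mu> (\<alpha> * v) \<in> W" using W nz by (simp add: v_def)
  ultimately have "\<forall>\<^sub>F u in nhds v. chart \<mu> (\<alpha> * u) \<in> W" by (metis W(1) topological_tendstoD)
  then obtain e where e: "e > 0" "\<And>u. dist u v < e \<Longrightarrow> chart \<mu> (\<alpha> * u) \<in> W"
    unfolding eventually_nhds_metric by blast
  define \<rho> where "\<rho> = norm v"
  have \<rho>: "\<rho> > 0" using v by (simp add: \<rho>_def)
  obtain \<theta> where \<theta>: "\<theta> \<notin> \<rat>" "\<mu>^2 = cis (2 * pi * \<theta>)" using generic_sq[OF \<mu>] .
  obtain j where j: "norm ((\<mu>^2)^j - cis (Arg v)) < e / (2 * \<rho>)"
    using irrational_rotation_dense[OF \<theta>(1), of "e / (2 * \<rho>)" "Arg v"] e \<rho> \<theta>(2) by auto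
  have vp: "v = of_real \<rho> * cis (Arg v)" using rcis_cmod_Arg[of v] by (simp add: rcis_def \<rho>_def)
  have nj: "norm ((\<mu>^2)^j) = 1" using generic_simps(1)[OF \<mu>] by (simp add: norm_power)
  define l where "l Q = \<lfloor>real Q * (ln \<rho> / 2)\<rfloor>" for Q :: nat
  have "(\<lambda>Q. 2 * of_int (l Q) / real Q) \<longlonglongrightarrow> ln \<rho>"
  proof (rule LIM_zero_cancel, rule Lim_null_comparison)
    show "(\<lambda>Q. 2 / real Q) \<longlonglongrightarrow> 0" by (rule lim_const_over_n)
    show "\<forall>\<^sub>F Q in sequentially. norm (2 * of_int (l Q) / real Q - ln \<rho>) \<le> 2 / real Q"
      using eventually_gt_at_top[of 0]
    proof eventually_elim
      case (elim Q)
      have "real Q * (ln \<rho> / 2) - 1 < of_int (l Q)" "of_int (l Q) \<le> real Q * (ln \<rho> / 2)"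
        unfolding l_def by linarith+
      then have "\<bar>2 * of_int (l Q) - real Q * ln \<rho>\<bar> \<le> 2" by linarith
      then have "\<bar>2 * of_int (l Q) - real Q * ln \<rho>\<bar> / real Q \<le> 2 / real Q"
        using elim by (intro divide_right_mono) auto
      moreover have "\<bar>2 * of_int (l Q) - real Q * ln \<rho>\<bar> / real Q = \<bar>2 * of_int (l Q) / real Q - ln \<rho>\<bar>"
        using elim by (simp add: abs_if field_simps)
      ultimately show ?case by simp
    qed
  qed
  then have "(\<lambda>Q. exp (2 * of_int (l Q) / real Q)) \<longlonglongrightarrow> exp (ln \<rho>)" by (rule tendsto_exp)
  then have "\<forall>\<^sub>F Q in sequentially. dist (exp (2 * of_int (l Q) / real Q)) (exp (ln \<rho>)) < e / 2"
    using e(1) by (intro tendstoD) auto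
  then have "\<forall>\<^sub>F Q in sequentially. chart \<mu> (\<alpha> * (of_real (exp (2 * of_int (l Q) / real Q)) * (\<mu>^2)^j)) \<in> W"
  proof eventually_elim
    case (elim Q)
    define E where "E = exp (2 * of_int (l Q) / real Q)"
    have "of_real E * (\<mu>^2)^j - v = of_real (E - \<rho>) * (\<mu>^2)^j + of_real \<rho> * ((\<mu>^2)^j - cis (Arg v))"
      by (subst vp) (simp add: algebra_simps)
    also have "norm \<dots> \<le> \<bar>E - \<rho>\<bar> + \<rho> * norm ((\<mu>^2)^j - cis (Arg v))"
      by (rule order_trans[OF norm_triangle_ineq]) (use \<rho> nj in \<open>simp add: norm_mult del: of_real_diff\<close>)
    also have "\<dots> < e / 2 + \<rho> * (e / (2 * \<rho>))"
      using elim \<rho> j by (intro add_strict_mono mult_strict_left_mono) (auto simp: E_def dist_real_def)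
    also have "\<dots> = e" using \<rho> by simp
    finally show ?case using e(2) by (simp add: dist_norm E_def)
  qed
  then have "\<forall>\<^sub>F Q in sequentially. \<exists>l. chart \<mu> (\<alpha> * (of_real (exp (2 * of_int l / real Q)) * (\<mu>^2)^j)) \<in> W"
    by eventually_elim (rule exI)
  then show ?thesis by (rule exI)
qed

text \<open>For \<open>\<mu>\<^sub>k = exp (1/(Q N\<^sub>k)) \<mu>\<close> with \<open>\<mu>\<^bsup>2 N\<^sub>k\<^esup> \<longlonglongrightarrow> 1\<close>, the powers \<open>\<mu>\<^sub>k\<^bsup>2(N\<^sub>k l + j)\<^esup>\<close> tend to
  \<open>exp (2l/Q) \<mu>\<^bsup>2j\<^esup>\<close>: slightly off the real fibre, \<open>g\<^sub>x\<close> moves a point along the whole fibre.\<close>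

lemma rotation_with_drift:
  fixes N :: "nat \<Rightarrow> nat" and \<mu> :: complex
  assumes \<mu>: "norm \<mu> = 1" and N: "\<And>k. N k > k" "(\<lambda>k. (\<mu>^2) ^ N k) \<longlonglongrightarrow> 1" and Q: "Q > 0"
  defines "m \<equiv> \<lambda>k. of_real (exp (1 / (real Q * real (N k)))) * \<mu>"
  shows "m \<longlonglongrightarrow> \<mu>"
    and "(\<lambda>k. (m k ^ 2) powi (int (N k) * l + int j)) \<longlonglongrightarrow> of_real (exp (2 * of_int l / real Q)) * (\<mu>^2)^j"
proof -
  have \<mu>0: "\<mu> \<noteq> 0" using \<mu> by auto
  have "filterlim N at_top sequentially"
    by (rule filterlim_at_top_mono[OF filterlim_ident]) (use N(1) in \<open>auto intro!: always_eventually less_imp_le\<close>)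
  then have "filterlim (\<lambda>k. real (N k)) at_top sequentially"
    using filterlim_compose filterlim_real_sequentially by blast
  then have inf: "filterlim (\<lambda>k. real Q * real (N k)) at_infinity sequentially"
    using Q by (intro filterlim_at_top_imp_at_infinity filterlim_tendsto_pos_mult_at_top[OF tendsto_const]) auto
  have lim0: "(\<lambda>k. c / (real Q * real (N k))) \<longlonglongrightarrow> 0" for c
    by (rule tendsto_divide_0[OF tendsto_const inf])
  have "(\<lambda>k. of_real (exp (1 / (real Q * real (N k)))) * \<mu>) \<longlonglongrightarrow> of_real (exp 0) * \<mu>"
    by (intro tendsto_intros lim0)
  then show "m \<longlonglongrightarrow> \<mu>" by (simp add: m_def)
  have eq: "(m k ^ 2) powi (int (N k) * l + int j)
      = of_real (exp (2 * of_int l / real Q + (2 * real j) / (real Q * real (N k)))) * (((\<mu>^2) ^ N k) powi l * (\<mu>^2)^j)" for k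
  proof -
    define n where "n = int (N k) * l + int j"
    define a where "a = 1 / (real Q * real (N k))"
    have Nk: "real (N k) > 0" using N(1)[of k] by simp
    have "(m k ^ 2) powi n = (of_real (exp a) ^ 2) powi n * (\<mu>^2) powi n"
      by (simp add: m_def a_def power_mult_distrib power_int_mult_distrib)
    also have "(of_real (exp a) ^ 2) powi n = (of_real ((exp (2 * a)) powi n) :: complex)"
      by (simp add: exp_double)
    also have "(exp (2 * a)) powi n = exp (of_int n * (2 * a))"
      by (simp add: exp_power_int)
    also have "of_int n * (2 * a) = 2 * of_int l / real Q + (2 * real j) / (real Q * real (N k))"
      using Nk Q by (simp add: n_def a_def field_simps)
    also have "(\<mu>^2) powi n = ((\<mu>^2) ^ N k) powi l * (\<mu>^2)^j"
      using \<mu>0 by (simp add: n_def power_int_add power_int_mult)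
    finally show ?thesis by (simp add: n_def)
  qed
  have "(\<lambda>k. of_real (exp (2 * of_int l / real Q + (2 * real j) / (real Q * real (N k)))) * (((\<mu>^2) ^ N k) powi l * (\<mu>^2)^j))
      \<longlonglongrightarrow> of_real (exp (2 * of_int l / real Q + 0)) * (1 powi l * (\<mu>^2)^j)"
    by (intro tendsto_intros lim0 N(2)) auto
  then show "(\<lambda>k. (m k ^ 2) powi (int (N k) * l + int j)) \<longlonglongrightarrow> of_real (exp (2 * of_int l / real Q)) * (\<mu>^2)^j"
    unfolding eq by simp
qed

lemma generic_fibre_coord:
  assumes \<mu>: "generic \<mu>" and p: "p \<in> S" "fst p = trc \<mu>"
  shows "coordA \<mu> p \<noteq> 0" "chart \<mu> (coordA \<mu> p) = p"
proof -
  show "coordA \<mu> p \<noteq> 0"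
    using coordA_mult[OF generic_simps(2,3)[OF \<mu>] p] generic_simps(4)[OF \<mu>] by auto
  then show "chart \<mu> (coordA \<mu> p) = p"
    using chart_coordA[OF generic_simps(2,3)[OF \<mu>] p] by blast
qed

text \<open>The powers of \<open>g_x\<close> used here act on fibres off the slit. The common point
  \<open>p\<close> is therefore taken on the fibre over \<open>x'\<close>: when \<open>x'\<close>
  belongs to a generic \<open>\<mu>\<close>, the whole orbit lies in the Julia set.\<close>

lemma common_orbit_point:
  assumes \<mu>: "generic \<mu>" and s: "A - trc \<mu> - x' \<noteq> 0"
    and U: "open U" "u \<in> U" "u \<in> S" "fst u = trc \<mu>"
    and V: "open V" "v \<in> V" "v \<in> S" "fst v = trc \<mu>"
  shows "\<exists>p\<in>S. fst p = x' \<and> (\<exists>q\<in>U. p \<asymp> q) \<and> (\<exists>q\<in>V. p \<asymp> q)"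
proof -
  note \<mu>s = generic_simps[OF \<mu>]
  define quart where "quart x = [:(A - x - x')^2, - (C * (A - x - x')), - (D + x*x'), -B, 1:]" for x
  have lc: "lead_coeff (quart x) = 1" "degree (quart x) = 4" for x by (simp_all add: quart_def)
  obtain y where y: "poly (quart (trc \<mu>)) y = 0"
    using monic_root_near[of "quart (trc \<mu>)" 0] lc by auto
  \<comment> \<open>The constant coefficient of the quartic is the square of the nonzero number in
    assumption \<open>s\<close>.\<close>
  have y0: "y \<noteq> 0" using y s by (auto simp: quart_def)
  define e where "e = (trc \<mu>, y, (A - trc \<mu> - x') / y)"
  have eS: "e \<in> S" unfolding e_def by (rule surf_from_trace_pair[OF y0 refl y[unfolded quart_def]])
  define \<alpha> where "\<alpha> = coordA \<mu> e"
  have \<alpha>: "\<alpha> \<noteq> 0" unfolding \<alpha>_def by (rule generic_fibre_coord[OF \<mu> eS]) (simp add: e_def)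
  obtain jU where jU: "\<forall>\<^sub>F Q in sequentially. \<exists>l. chart \<mu> (\<alpha> * (of_real (exp (2 * of_int l / real Q)) * (\<mu>^2)^jU)) \<in> U"
    using generic_rotation_approx[OF \<mu> U(1) _ _ \<alpha>] generic_fibre_coord[OF \<mu> U(3,4)] U(2) by metis
  obtain jV where jV: "\<forall>\<^sub>F Q in sequentially. \<exists>l. chart \<mu> (\<alpha> * (of_real (exp (2 * of_int l / real Q)) * (\<mu>^2)^jV)) \<in> V"
    using generic_rotation_approx[OF \<mu> V(1) _ _ \<alpha>] generic_fibre_coord[OF \<mu> V(3,4)] V(2) by metis
  \<comment> \<open>A single \<open>Q\<close> is needed, since the perturbation \<open>m\<close>
    depends on it and both sets must be reached from the same point \<open>p k\<close>.\<close>
  obtain Q lU lV where Q: "Q > (0::nat)"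
    and lU: "chart \<mu> (\<alpha> * (of_real (exp (2 * of_int lU / real Q)) * (\<mu>^2)^jU)) \<in> U"
    and lV: "chart \<mu> (\<alpha> * (of_real (exp (2 * of_int lV / real Q)) * (\<mu>^2)^jV)) \<in> V"
    using eventually_happens[OF eventually_conj[OF eventually_gt_at_top[of 0] eventually_conj[OF jU jV]]] by auto
  obtain \<theta> where \<theta>: "\<theta> \<notin> \<rat>" "\<mu>^2 = cis (2 * pi * \<theta>)" using generic_sq[OF \<mu>] .
  obtain N :: "nat \<Rightarrow> nat" where N: "\<And>k. N k > k" "(\<lambda>k. (\<mu>^2) ^ N k) \<longlonglongrightarrow> 1"
    using irrational_rotation_returns[OF \<theta>(1)] unfolding \<theta>(2) by blast
  define m where "m k = of_real (exp (1 / (real Q * real (N k)))) * \<mu>" for k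
  have m: "m \<longlonglongrightarrow> \<mu>"
    "\<And>l j. (\<lambda>k. (m k ^ 2) powi (int (N k) * l + int j)) \<longlonglongrightarrow> of_real (exp (2 * of_int l / real Q)) * (\<mu>^2)^j"
    unfolding m_def by (rule rotation_with_drift[OF \<mu>s(1) N Q])+
  have m0: "m k \<noteq> 0" for k using \<mu>s(2) by (simp add: m_def)
  have x: "(\<lambda>k. trc (m k)) \<longlonglongrightarrow> trc \<mu>"
    unfolding trc_def by (intro tendsto_intros m \<mu>s)
  have "(\<lambda>k. poly (quart (trc (m k))) y) \<longlonglongrightarrow> poly (quart (trc \<mu>)) y"
    unfolding quart_def by (simp, intro tendsto_intros x)
  \<comment> \<open>On the perturbed fibres the quartic keeps a root near \<open>y\<close>, so
    \<open>p k\<close> tends to \<open>e\<close> while its image under \<open>s_x\<close> stays over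
    \<open>x'\<close>.\<close>
  then obtain Y where Y: "\<And>k. poly (quart (trc (m k))) (Y k) = 0" "Y \<longlonglongrightarrow> y"
    using monic_roots_tendsto[of "\<lambda>k. quart (trc (m k))" 4 y] lc y by auto
  define p where "p k = (trc (m k), Y k, (A - trc (m k) - x') / Y k)" for k
  have p: "p \<longlonglongrightarrow> e" unfolding p_def e_def by (intro tendsto_intros x Y y0)
  define a where "a k = coordA (m k) (p k)" for k
  have a: "a \<longlonglongrightarrow> \<alpha>" unfolding a_def \<alpha>_def
    by (rule tendsto_coordA[OF m(1) p \<mu>s(2,3)]) (use trc_discr(2)[OF \<mu>s(2,3)] in \<open>simp add: e_def\<close>)
  have ch: "(\<lambda>k. chart (m k) (a k * (m k ^ 2) powi (int (N k) * l + int j))) \<longlonglongrightarrow>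
      chart \<mu> (\<alpha> * (of_real (exp (2 * of_int l / real Q)) * (\<mu>^2)^j))" for l j
    by (intro tendsto_chart m tendsto_mult a) (use \<mu>s \<alpha> in auto)
  have "\<forall>\<^sub>F k in sequentially. Y k \<noteq> 0 \<and> (m k)^2 \<noteq> 1 \<and> a k \<noteq> 0
     \<and> chart (m k) (a k * (m k ^ 2) powi (int (N k) * lU + int jU)) \<in> U
     \<and> chart (m k) (a k * (m k ^ 2) powi (int (N k) * lV + int jV)) \<in> V"
    by (intro eventually_conj tendsto_imp_eventually_ne[OF Y(2) y0] tendsto_imp_eventually_ne[OF a \<alpha>]
      tendsto_imp_eventually_ne[OF tendsto_power[OF m(1)] \<mu>s(3)]
      topological_tendstoD[OF ch U(1) lU] topological_tendstoD[OF ch V(1) lV])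
  then obtain k where k: "Y k \<noteq> 0" "(m k)^2 \<noteq> 1" "a k \<noteq> 0"
     "chart (m k) (a k * (m k ^ 2) powi (int (N k) * lU + int jU)) \<in> U"
     "chart (m k) (a k * (m k ^ 2) powi (int (N k) * lV + int jV)) \<in> V"
    using eventually_happens by fastforce
  have pS: "p k \<in> S"
    unfolding p_def by (rule surf_from_trace_pair[OF k(1) refl Y(1)[unfolded quart_def]])
  have "chart (m k) (a k) = p k"
    unfolding a_def by (rule chart_coordA[OF m0 k(2) pS]) (use k(3) in \<open>auto simp: p_def a_def\<close>)
  then have pk: "p k \<asymp> chart (m k) (a k * (m k ^ 2) powi n)" for n
    using orbit_equiv_chart_powi[OF m0 k(2), of "a k" n] k(3) by simp
  define p' where "p' = s_z C (s_x A (p k))"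
  have p': "p k \<asymp> p'" unfolding p'_def by (rule orbit_equiv_g_y_inv[OF pS])
  have "fst p' = x'" using k(1) by (simp add: p'_def p_def s_x_def s_z_def)
  moreover have "p' \<asymp> chart (m k) (a k * (m k ^ 2) powi n)" for n
    using orbit_equiv_trans[OF orbit_equiv_sym[OF p'] pk] .
  ultimately show ?thesis using k(4,5) orbit_equiv_surf(2)[OF p'] by blast
qed

section \<open>Generic fibres lie in the Julia set\<close>

lemma restrict_funpow_grp: "restrict ((s_z C \<circ> s_y B) ^^ n) S \<in> \<Gamma>"
proof (induction n)
  case 0
  have "compose S (restrict (s_z C \<circ> s_y B) S) (restrict (s_y B \<circ> s_z C) S) \<in> \<Gamma>"
    by (rule grp_compose[OF grp_generators(1,4)])
  also have "compose S (restrict (s_z C \<circ> s_y B) S) (restrict (s_y B \<circ> s_z C) S) = restrict ((s_z C \<circ> s_y B) ^^ 0) S"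
    by (rule ext) (simp add: compose_def restrict_def s_y_surf s_z_surf)
  finally show ?case .
next
  case (Suc n)
  have "((s_z C \<circ> s_y B) ^^ n) p \<in> S" if "p \<in> S" for p
    using that by (induction n) (simp_all add: s_y_surf s_z_surf)
  then have "compose S (restrict (s_z C \<circ> s_y B) S) (restrict ((s_z C \<circ> s_y B) ^^ n) S) = restrict ((s_z C \<circ> s_y B) ^^ Suc n) S"
    by (intro ext) (simp add: compose_def restrict_def)
  then show ?case using grp_compose[OF grp_generators(1) Suc] by metis
qed

lemma funpow_chart:
  assumes "\<mu> \<noteq> 0" "\<mu>^2 \<noteq> 1"
  shows "((s_z C \<circ> s_y B) ^^ n) (chart \<mu> \<alpha>) = chart \<mu> (\<alpha> * (\<mu>^2)^n)"
  by (induction n) (simp_all add: g_x_chart[OF assms] mult.assoc mult.left_commute power_Suc2 del: power_Suc)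

text \<open>Powers of \<open>g_x\<close> keep \<open>q\<close> on a compact circle of its fibre,
  which rules out convergence to infinity; a point of \<open>U\<close> on a nearby fibre with
  \<open>norm \<nu> > 1\<close> has an unbounded orbit, which rules out convergence.\<close>

lemma generic_fibre_subset_julia:
  assumes \<mu>: "generic \<mu>" and q: "q \<in> S" "fst q = trc \<mu>"
  shows "q \<in> julia A B C D"
proof (rule ccontr)
  note \<mu>s = generic_simps[OF \<mu>]
  assume "q \<notin> julia A B C D"
  then have "q \<in> fatou A B C D" using q(1) by (simp add: julia_def)
  then obtain U where U: "openin (top_of_set S) U" "q \<in> U" "normal_family_on S \<Gamma> U"
    by (auto simp: fatou_def)
  obtain W where W: "open W" "U = S \<inter> W" using U(1) by (auto simp: openin_open)
  define f where "f n = restrict ((s_z C \<circ> s_y B) ^^ n) S" for n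
  have "\<forall>n. f n \<in> \<Gamma>" using restrict_funpow_grp by (simp add: f_def)
  then obtain r :: "nat \<Rightarrow> nat" where r: "strict_mono r" "converges_loc_unif (f \<circ> r) U \<or> converges_to_infinity S (f \<circ> r) U"
    using U(3) unfolding normal_family_on_def by blast
  define \<alpha> where "\<alpha> = coordA \<mu> q"
  have \<alpha>: "\<alpha> \<noteq> 0" "chart \<mu> \<alpha> = q" using generic_fibre_coord[OF \<mu> q] by (auto simp: \<alpha>_def)
  have f: "f n (chart \<nu> a) = chart \<nu> (a * (\<nu>^2)^n)" if "\<nu> \<noteq> 0" "\<nu>^2 \<noteq> 1" "a \<noteq> 0" for n \<nu> a
    using funpow_chart[OF that(1,2)] chart_in_surf[OF that(1,2)] that(3) by (simp add: f_def)
  from r(2) show False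
  proof
    assume "converges_loc_unif (f \<circ> r) U"
    then obtain l where l: "\<And>V. compact V \<Longrightarrow> V \<subseteq> U \<Longrightarrow> uniform_limit V (f \<circ> r) l sequentially"
      unfolding converges_loc_unif_def by blast
    define m where "m k = of_real (exp (1 / real (Suc k))) * \<mu>" for k
    have "(\<lambda>k. of_real (exp (1 / real (Suc k))) * \<mu>) \<longlonglongrightarrow> of_real (exp 0) * \<mu>"
      unfolding inverse_eq_divide[symmetric] by (intro tendsto_intros LIMSEQ_inverse_real_of_nat)
    then have m: "m \<longlonglongrightarrow> \<mu>" by (simp add: m_def[abs_def])
    have "\<forall>\<^sub>F k in sequentially. (m k)^2 \<noteq> 1 \<and> chart (m k) \<alpha> \<in> W"
      using \<alpha> U(2) \<mu>s W
      by (intro eventually_conj tendsto_imp_eventually_ne[OF tendsto_power[OF m] \<mu>s(3)]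
        topological_tendstoD[OF tendsto_chart[OF m tendsto_const]]) auto
    then obtain k where k: "(m k)^2 \<noteq> 1" "chart (m k) \<alpha> \<in> W" using eventually_happens by fastforce
    define \<nu> where "\<nu> = m k"
    have \<nu>: "norm \<nu> > 1" "\<nu> \<noteq> 0" using \<mu>s by (simp_all add: \<nu>_def m_def norm_mult)
    have inU: "chart \<nu> \<alpha> \<in> U"
      using k chart_in_surf[OF \<nu>(2)] \<alpha>(1) by (auto simp: \<nu>_def W)
    have "uniform_limit {chart \<nu> \<alpha>} (f \<circ> r) l sequentially" by (rule l) (use inU in auto)
    then have "(\<lambda>n. (f \<circ> r) n (chart \<nu> \<alpha>)) \<longlonglongrightarrow> l (chart \<nu> \<alpha>)"
      by (rule tendsto_uniform_limitI) simp
    then have "(\<lambda>n. chart \<nu> (\<alpha> * (\<nu>^2)^(r n))) \<longlonglongrightarrow> l (chart \<nu> \<alpha>)"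
      using f[OF \<nu>(2) _ \<alpha>(1)] k(1) by (simp add: \<nu>_def)
    then have "(\<lambda>n. fst (snd (chart \<nu> (\<alpha> * (\<nu>^2)^(r n))))) \<longlonglongrightarrow> fst (snd (l (chart \<nu> \<alpha>)))"
      by (intro tendsto_fst tendsto_snd)
    then have lim: "(\<lambda>n. cY (trc \<nu>) + \<alpha> * (\<nu>^2)^(r n) + \<kappa> (trc \<nu>) / (\<alpha> * (\<nu>^2)^(r n))) \<longlonglongrightarrow> fst (snd (l (chart \<nu> \<alpha>)))"
      by (simp add: chart_def)
    have "norm (\<nu>^2) > 1" using \<nu>(1) by (simp add: norm_power one_less_power)
    then have "filterlim (\<lambda>n. (\<nu>^2)^n) at_infinity sequentially"
      by (rule filterlim_realpow_sequentially_gt1)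
    then have "filterlim (\<lambda>n. (\<nu>^2)^(r n)) at_infinity sequentially"
      using filterlim_compose filterlim_subseq[OF r(1)] by blast
    then have inf: "filterlim (\<lambda>n. \<alpha> * (\<nu>^2)^(r n)) at_infinity sequentially"
      by (rule tendsto_mult_filterlim_at_infinity[OF tendsto_const \<alpha>(1)])
    have "(\<lambda>n. \<kappa> (trc \<nu>) / (\<alpha> * (\<nu>^2)^(r n))) \<longlonglongrightarrow> 0"
      by (rule tendsto_divide_0[OF tendsto_const inf])
    \<comment> \<open>Removing the centre and the vanishing \<open>\<beta>\<close> term from the
      second coordinate would leave a convergent \<open>\<alpha>\<close> term, although that term
      tends to infinity.\<close>
    from tendsto_diff[OF lim tendsto_add[OF this tendsto_const[of "cY (trc \<nu>)"]]]
    have "(\<lambda>n. \<alpha> * (\<nu>^2)^(r n)) \<longlonglongrightarrow> fst (snd (l (chart \<nu> \<alpha>))) - (0 + cY (trc \<nu>))"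
      by (simp add: algebra_simps)
    then show False using inf not_tendsto_and_filterlim_at_infinity[of sequentially] by fastforce
  next
    assume inf: "converges_to_infinity S (f \<circ> r) U"
    let ?K = "chart \<mu> ` sphere 0 (norm \<alpha>)"
    have "continuous (at a within sphere 0 (norm \<alpha>)) (chart \<mu>)" if "a \<in> sphere 0 (norm \<alpha>)" for a
      unfolding continuous_within
      by (rule tendsto_chart) (use that \<alpha>(1) \<mu>s in \<open>auto intro: tendsto_ident_at\<close>)
    then have "compact ?K"
      by (intro compact_continuous_image) (auto simp: continuous_on_eq_continuous_within)
    moreover have "?K \<subseteq> S"
      by (rule image_subsetI, rule chart_in_surf[OF \<mu>s(2,3)]) (use \<alpha>(1) in auto)
    ultimately have "finite {i. (f \<circ> r) i ` {q} \<inter> ?K \<noteq> {}}"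
      using inf U(2) unfolding converges_to_infinity_def by (metis compact_sing empty_subsetI insert_subset)
    moreover have "(f \<circ> r) i q \<in> ?K" for i
      using f[OF \<mu>s(2,3) \<alpha>(1), of "r i"] \<mu>s(1) unfolding \<alpha>(2)[symmetric]
      by (auto intro!: imageI simp: norm_mult norm_power)
    then have "{i. (f \<circ> r) i ` {q} \<inter> ?K \<noteq> {}} = UNIV" by blast
    ultimately show False by simp
  qed
qed

section \<open>Reaching the slit\<close>

text \<open>Keep y, move the first coordinate to a nearby generic value, and let z follow as a root
  of the surface equation, which is a monic quadratic in z.\<close>

lemma slit_generic_near:
  assumes p: "p \<in> S" "fst p \<in> slit" and U: "open U" "p \<in> U" and F: "finite F"
  shows "\<exists>q\<in>S \<inter> U. \<exists>\<mu>. generic \<mu> \<and> fst q = trc \<mu> \<and> trc \<mu> \<notin> F"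
proof -
  obtain \<xi> y z where pp: "p = (of_real \<xi>, y, z)" and \<xi>: "-2 \<le> \<xi>" "\<xi> \<le> 2"
    using p(2) by (cases p) (auto simp: slit_def)
  have "\<exists>\<mu> r. generic \<mu> \<and> trc \<mu> = of_real r \<and> \<bar>r - \<xi>\<bar> < 1 / Suc k \<and> trc \<mu> \<notin> F" for k
  proof -
    have "\<exists>\<mu> r. generic \<mu> \<and> trc \<mu> = of_real r \<and> max (-2) (\<xi> - 1 / Suc k) < r \<and> r < min 2 (\<xi> + 1 / Suc k) \<and> trc \<mu> \<notin> F"
    proof (rule generic_dense[OF _ _ _ F])
      have "1 / real (Suc k) > 0" by simp
      then show "max (-2) (\<xi> - 1 / Suc k) < min 2 (\<xi> + 1 / Suc k)" using \<xi> by linarith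
    qed auto
    then show ?thesis by (auto simp: abs_less_iff)
  qed
  then obtain m r where m: "\<And>k. generic (m k)" "\<And>k. trc (m k) = of_real (r k)"
    "\<And>k. \<bar>r k - \<xi>\<bar> < 1 / Suc k" "\<And>k. trc (m k) \<notin> F" by metis
  have "(\<lambda>k. r k - \<xi>) \<longlonglongrightarrow> 0"
    by (rule Lim_null_comparison[OF _ LIMSEQ_inverse_real_of_nat])
      (use m(3) in \<open>simp add: inverse_eq_divide less_imp_le\<close>)
  then have "r \<longlonglongrightarrow> \<xi>" by (rule LIM_zero_cancel)
  then have x: "(\<lambda>k. trc (m k)) \<longlonglongrightarrow> of_real \<xi>" unfolding m(2) by (rule tendsto_of_real)
  define quad where "quad x = [:x^2 + y^2 - A*x - B*y - D, x*y - C, 1:]" for x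
  have quad: "poly (quad x) w = 0 \<longleftrightarrow> (x, y, w) \<in> S" for x w
    by (auto simp: quad_def surf_def algebra_simps power2_eq_square)
  have "(\<lambda>k. poly (quad (trc (m k))) z) \<longlonglongrightarrow> poly (quad (of_real \<xi>)) z"
    unfolding quad_def by (simp, intro tendsto_intros x)
  moreover have "poly (quad (of_real \<xi>)) z = 0" using quad p(1) by (simp add: pp)
  moreover have "lead_coeff (quad x) = 1" "degree (quad x) = 2" for x by (simp_all add: quad_def)
  ultimately obtain Z where Z: "\<And>k. poly (quad (trc (m k))) (Z k) = 0" "Z \<longlonglongrightarrow> z"
    using monic_roots_tendsto[of "\<lambda>k. quad (trc (m k))" 2 z] by auto
  have "(\<lambda>k. (trc (m k), y, Z k)) \<longlonglongrightarrow> p"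
    unfolding pp by (intro tendsto_intros x Z)
  then have "\<forall>\<^sub>F k in sequentially. (trc (m k), y, Z k) \<in> U"
    using U by (rule topological_tendstoD)
  then obtain k where "(trc (m k), y, Z k) \<in> U" using eventually_happens by fastforce
  moreover have "(trc (m k), y, Z k) \<in> S" using quad Z(1) by blast
  ultimately show ?thesis using m(1,4) by (intro bexI[of _ "(trc (m k), y, Z k)"]) auto
qed

text \<open>At the centre of a degenerate fibre \<open>g\<^sub>x\<close> expands the line \<open>\<beta> = 0\<close>, on which the first
  coordinate of \<open>g\<^sub>y\<inverse>\<close> is a nonconstant polynomial and hence takes the value \<open>0\<close>.\<close>

lemma degenerate_center_reaches_slit:
  assumes \<mu>: "norm \<mu> > 1" and p: "p \<in> S" "fst p = trc \<mu>"
    and c: "coordA \<mu> p = 0" "coordA (1/\<mu>) p = 0" and W: "open W" "p \<in> W"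
  shows "\<exists>q\<in>W. \<exists>q'. q \<asymp> q' \<and> fst q' \<in> slit"
proof -
  have "norm (\<mu>^2) > 1" using \<mu> by (simp add: norm_power one_less_power)
  then have \<mu>0: "\<mu> \<noteq> 0" "\<mu>^2 \<noteq> 1" using \<mu> by auto
  have \<kappa>: "\<kappa> (trc \<mu>) = 0" using coordA_mult[OF \<mu>0 p] c by simp
  have ch: "chart \<mu> a = (trc \<mu>, cY (trc \<mu>) + a, cZ (trc \<mu>) + a * \<mu>)" for a
    by (simp add: chart_def \<kappa>)
  have p0: "chart \<mu> 0 = p" using chart_coordA[OF \<mu>0 p] c by simp
  \<comment> \<open>Up to sign, \<open>P\<close> is A - x - yz along the line
    \<open>\<beta> = 0\<close>; its leading coefficient is \<open>\<mu>\<close>.\<close>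
  define P where "P = [:cY (trc \<mu>), 1:] * [:cZ (trc \<mu>), \<mu>:] - [:A - trc \<mu>:]"
  have "degree P = 2" using \<mu>0(1) by (simp add: P_def)
  then obtain \<alpha> where \<alpha>: "poly P \<alpha> = 0"
    using fundamental_theorem_of_algebra[of P] constant_degree[of P] by auto
  define q' where "q' = s_z C (s_x A (chart \<mu> \<alpha>))"
  have "fst q' = 0" using \<alpha> by (simp add: q'_def ch s_x_def s_z_def P_def algebra_simps)
  then have slit: "fst q' \<in> slit" by (auto simp: slit_def intro!: image_eqI[of _ _ 0])
  have "chart \<mu> \<alpha> \<asymp> q'"
    unfolding q'_def by (intro orbit_equiv_g_y_inv chart_in_surf \<mu>0) (simp add: \<kappa>)
  moreover have "(\<lambda>n. chart \<mu> (\<alpha> * (\<mu>^2) powi (- int n))) \<longlonglongrightarrow> p"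
  proof -
    \<comment> \<open>Backward iteration contracts the line to its centre \<open>p\<close>, so the
      orbit of \<open>chart \<mu> \<alpha>\<close> enters \<open>W\<close>.\<close>
    have "(\<lambda>n. inverse ((\<mu>^2) ^ n)) \<longlonglongrightarrow> 0"
      using \<open>norm (\<mu>^2) > 1\<close> by (intro tendsto_inverse_0[THEN filterlim_compose] filterlim_realpow_sequentially_gt1)
    then have "(\<lambda>n. \<alpha> * (\<mu>^2) powi (- int n)) \<longlonglongrightarrow> \<alpha> * 0"
      by (intro tendsto_intros) (simp add: power_int_minus)
    then have lim: "(\<lambda>n. \<alpha> * (\<mu>^2) powi (- int n)) \<longlonglongrightarrow> 0" by simp
    have "(\<lambda>n. (trc \<mu>, cY (trc \<mu>) + \<alpha> * (\<mu>^2) powi (- int n), cZ (trc \<mu>) + \<alpha> * (\<mu>^2) powi (- int n) * \<mu>))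
        \<longlonglongrightarrow> (trc \<mu>, cY (trc \<mu>) + 0, cZ (trc \<mu>) + 0 * \<mu>)"
      by (intro tendsto_Pair tendsto_add tendsto_mult tendsto_const lim)
    then show ?thesis unfolding p0[symmetric] ch .
  qed
  then have "\<forall>\<^sub>F n in sequentially. chart \<mu> (\<alpha> * (\<mu>^2) powi (- int n)) \<in> W"
    using W by (rule topological_tendstoD)
  then obtain n where "chart \<mu> (\<alpha> * (\<mu>^2) powi (- int n)) \<in> W" using eventually_happens by fastforce
  moreover have "chart \<mu> \<alpha> \<asymp> chart \<mu> (\<alpha> * (\<mu>^2) powi (- int n))"
    by (rule orbit_equiv_chart_powi[OF \<mu>0]) (simp add: \<kappa>)
  ultimately show ?thesis using slit orbit_equiv_sym orbit_equiv_trans by blast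
qed

section \<open>Normality where all images omit the slit\<close>

text \<open>The smaller of |y| and |z| has square at most |yz|, hence is bounded; the surface
  equation then bounds the square of the larger one by an affine function of itself.
  \<open>key\<close> does this once for both orders.\<close>

lemma surf_bounded_if:
  "\<exists>N. \<forall>(x, y, z)\<in>S. norm x \<le> M \<and> norm (y * z) \<le> M \<longrightarrow> norm (x, y, z) \<le> N"
proof -
  \<comment> \<open>The first four terms bound \<open>w\<close>, the next \<open>M\<close> bounds
    the square of the smaller coordinate, and the last term bounds its linear contribution, with
    \<open>norm B + norm C\<close> serving both orders.\<close>
  define L where "L = norm A * M + norm D + M^2 + M * M + M + (norm B + norm C) * (M + 1)"
  define R where "R = norm B + norm C + L + M + 2"
  have key: "norm y \<le> b + L + 1"
    if h: "norm z \<le> norm y" "norm (y * z) \<le> M" "norm (y^2) \<le> b * norm y + (L0 + norm (z^2) + b' * norm z)"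
      "L0 + M + b' * (M + 1) \<le> L" "0 \<le> b" "0 \<le> b'" "0 \<le> L" "0 \<le> M" for y z :: complex and b b' L0
  proof (rule ccontr)
    assume c: "\<not> norm y \<le> b + L + 1"
    have "norm z * norm z \<le> norm y * norm z" using h(1) by (intro mult_right_mono) auto
    then have z2: "norm (z^2) \<le> M" using h(2) by (simp add: norm_mult power2_eq_square)
    have z1: "norm z \<le> M + 1"
    proof (rule ccontr)
      assume "\<not> norm z \<le> M + 1"
      then have "(M + 1) * (M + 1) < norm z * norm z" using h(8) by (intro mult_strict_mono) auto
      moreover have "M \<le> (M + 1) * (M + 1)" using h(8) by (simp add: algebra_simps)
      ultimately show False using z2 by (simp add: norm_mult power2_eq_square)
    qed
    have "b' * norm z \<le> b' * (M + 1)" using z1 h(6) by (intro mult_left_mono) auto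
    then have 1: "norm y * norm y \<le> b * norm y + L"
      using h(3,4) z2 by (simp add: norm_mult power2_eq_square)
    have "(b + L + 1) * norm y \<le> norm y * norm y" using c by (intro mult_right_mono) auto
    moreover have "L * 1 \<le> L * norm y" using c h(5,7) by (intro mult_left_mono) auto
    moreover have "norm y \<ge> 1" using c h(5,7) by linarith
    ultimately show False using 1 by (simp add: algebra_simps)
  qed
  have "norm (x, y, z) \<le> M + R + R" if "(x, y, z) \<in> S" and x: "norm x \<le> M" and yz: "norm (y * z) \<le> M" for x y z
  proof -
    have M: "0 \<le> M" using x norm_ge_zero order_trans by blast
    have L: "0 \<le> L" using M unfolding L_def by (intro add_nonneg_nonneg mult_nonneg_nonneg) auto
    define w where "w = A * x + D - x^2 - x * (y * z)"
    have eq: "x^2 + y^2 + z^2 + x * y * z = A * x + B * y + C * z + D" using that(1) by (simp add: surf_def)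
    have w: "norm w \<le> norm A * M + norm D + M^2 + M * M"
    proof -
      have "norm w \<le> norm (A * x) + norm D + norm (x^2) + norm (x * (y * z))"
        unfolding w_def by (intro order_trans[OF norm_triangle_ineq4] add_mono norm_triangle_ineq order_refl)
      also have "\<dots> \<le> norm A * M + norm D + M^2 + M * M"
        unfolding norm_mult[of A] norm_mult[of x] norm_power
        using x yz M by (intro add_mono mult_mono power_mono mult_left_mono) auto
      finally show ?thesis .
    qed
    have y2: "y^2 = B * y + (w - z^2 + C * z)" and z2: "z^2 = C * z + (w - y^2 + B * y)"
      using eq by (simp_all add: w_def algebra_simps)
    have ny: "norm (y^2) \<le> norm B * norm y + (norm w + norm (z^2) + norm C * norm z)"
      by (subst y2) (intro order_trans[OF norm_triangle_ineq] add_mono order_trans[OF norm_triangle_ineq4] order_refl norm_mult_ineq)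
    have nz: "norm (z^2) \<le> norm C * norm z + (norm w + norm (y^2) + norm B * norm y)"
      by (subst z2) (intro order_trans[OF norm_triangle_ineq] add_mono order_trans[OF norm_triangle_ineq4] order_refl norm_mult_ineq)
    have LL: "norm w + M + norm C * (M + 1) \<le> L" "norm w + M + norm B * (M + 1) \<le> L"
    proof -
      have "0 \<le> norm B * (M + 1)" "0 \<le> norm C * (M + 1)" using M by auto
      then show "norm w + M + norm C * (M + 1) \<le> L" "norm w + M + norm B * (M + 1) \<le> L"
        using w unfolding L_def distrib_right by linarith+
    qed
    have "norm y \<le> R \<and> norm z \<le> R"
    proof (cases "norm z \<le> norm y")
      case True
      have "norm y \<le> norm B + L + 1" by (rule key[OF True yz ny LL(1)]) (use L M in auto)
      also have "\<dots> \<le> R" using M by (simp add: R_def)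
      finally show ?thesis using True by linarith
    next
      case False
      have "norm z \<le> norm C + L + 1"
        by (rule key[OF _ _ nz LL(2)]) (use False L M yz in \<open>auto simp: mult.commute\<close>)
      also have "\<dots> \<le> R" using M by (simp add: R_def)
      finally show ?thesis using False by linarith
    qed
    then show ?thesis using x norm_triple_le[of "(x, y, z)"] by simp
  qed
  then show ?thesis by (intro exI[of _ "M + R + R"]) auto
qed

text \<open>Off the slit there are two branches of the fibre parameter, \<open>joukowski_inv\<close>
  and its reciprocal; \<open>nc\<close> selects one whose eigencoordinate is nonzero at
  \<open>p\<close>. Parameters depend continuously on the point, so those near \<open>c\<close>
  cover a neighbourhood of \<open>p\<close>.\<close>

lemma local_chart:
  assumes p: "p \<in> S" "fst p \<notin> slit"
    and nc: "coordA (joukowski_inv (fst p)) p \<noteq> 0 \<or> coordA (1 / joukowski_inv (fst p)) p \<noteq> 0"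
  obtains c where "fst c \<noteq> 0" "(fst c)^2 \<noteq> 1" "snd c \<noteq> 0" "chart (fst c) (snd c) = p"
    "\<And>r. r > 0 \<Longrightarrow> \<exists>U. openin (top_of_set S) U \<and> p \<in> U \<and> (\<forall>q\<in>U. \<exists>t\<in>ball c r. chart (fst t) (snd t) = q)"
proof -
  have jc: "continuous_on (- slit) joukowski_inv"
    by (rule holomorphic_on_imp_continuous_on[OF joukowski_inv_hol])
  have jsq: "(joukowski_inv x)^2 \<noteq> 1" if "x \<notin> slit" for x
  proof
    assume "(joukowski_inv x)^2 = 1"
    then have "norm (joukowski_inv x) ^ 2 = 1" by (metis norm_one norm_power)
    then show False using joukowski_inv(2)[OF that] by (simp add: abs_square_eq_1)
  qed
  obtain br where br: "continuous_on (- slit) br" "coordA (br (fst p)) p \<noteq> 0"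
    "\<And>x. x \<notin> slit \<Longrightarrow> br x \<noteq> 0" "\<And>x. x \<notin> slit \<Longrightarrow> (br x)^2 \<noteq> 1" "\<And>x. x \<notin> slit \<Longrightarrow> trc (br x) = x"
  proof (cases "coordA (joukowski_inv (fst p)) p = 0")
    case False
    show thesis
    proof (rule that[OF jc False])
      fix x assume x: "x \<notin> slit"
      show "joukowski_inv x \<noteq> 0" "(joukowski_inv x)^2 \<noteq> 1" using joukowski_inv(1) jsq x by auto
      show "trc (joukowski_inv x) = x" using joukowski_inv(3)[OF x] by (simp add: trc_def)
    qed
  next
    case True
    show thesis
    proof (rule that[of "\<lambda>x. 1 / joukowski_inv x"])
      show "continuous_on (- slit) (\<lambda>x. 1 / joukowski_inv x)"
        using joukowski_inv(1) by (intro continuous_intros jc) auto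
      show "coordA (1 / joukowski_inv (fst p)) p \<noteq> 0" using nc True by simp
      fix x assume x: "x \<notin> slit"
      show "1 / joukowski_inv x \<noteq> 0" "(1 / joukowski_inv x)^2 \<noteq> 1"
        using joukowski_inv(1) jsq x by (auto simp: power_divide)
      show "trc (1 / joukowski_inv x) = x" using joukowski_inv(3)[OF x] by (simp add: trc_def add.commute)
    qed
  qed
  define G where "G = S \<inter> fst -` (- slit)"
  define \<Phi> where "\<Phi> q = (br (fst q), coordA (br (fst q)) q)" for q
  have opG: "openin (top_of_set S) G"
    unfolding G_def using closed_slit by (intro continuous_openin_preimage_gen continuous_intros) auto
  have brG: "br (fst q) \<noteq> 0" "(br (fst q))^2 \<noteq> 1" "trc (br (fst q)) = fst q" if "q \<in> G" for q
    using that br(3-5) by (auto simp: G_def)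
  have "continuous_on G \<Phi>"
    unfolding continuous_on_def
  proof
    fix q assume q: "q \<in> G"
    have "continuous_on G (\<lambda>q. br (fst q))"
      by (rule continuous_on_compose2[OF br(1)]) (auto simp: G_def intro!: continuous_intros)
    then have b: "((\<lambda>q. br (fst q)) \<longlongrightarrow> br (fst q)) (at q within G)"
      using q unfolding continuous_on_def by blast
    have "4 - (fst q)^2 \<noteq> 0" using trc_discr(2)[OF brG(1,2)[OF q]] brG(3)[OF q] by simp
    then show "(\<Phi> \<longlongrightarrow> \<Phi> q) (at q within G)"
      unfolding \<Phi>_def by (intro tendsto_Pair b tendsto_coordA brG[OF q] tendsto_ident_at)
  qed
  then have op: "openin (top_of_set G) (G \<inter> \<Phi> -` (ball (\<Phi> p) r \<inter> {t. snd t \<noteq> 0}))" for r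
    by (intro continuous_openin_preimage_gen open_Int open_ball open_Collect_neq continuous_intros)
  have chart: "chart (fst (\<Phi> q)) (snd (\<Phi> q)) = q" if "q \<in> G" "snd (\<Phi> q) \<noteq> 0" for q
    unfolding \<Phi>_def fst_conv snd_conv
    by (rule chart_coordA) (use that brG[OF that(1)] in \<open>auto simp: \<Phi>_def G_def\<close>)
  have pG: "p \<in> G" using p by (simp add: G_def)
  show thesis
  proof (rule that[of "\<Phi> p"])
    show "fst (\<Phi> p) \<noteq> 0" "(fst (\<Phi> p))^2 \<noteq> 1" "snd (\<Phi> p) \<noteq> 0"
      using brG[OF pG] br(2) by (auto simp: \<Phi>_def)
    then show "chart (fst (\<Phi> p)) (snd (\<Phi> p)) = p" using chart[OF pG] by blast
    fix r :: real assume "r > 0"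
    let ?U = "G \<inter> \<Phi> -` (ball (\<Phi> p) r \<inter> {t. snd t \<noteq> 0})"
    have "openin (top_of_set S) ?U" using openin_trans[OF op opG] .
    moreover have "p \<in> ?U" using pG \<open>r > 0\<close> \<open>snd (\<Phi> p) \<noteq> 0\<close> by simp
    moreover have "\<exists>t\<in>ball (\<Phi> p) r. chart (fst t) (snd t) = q" if "q \<in> ?U" for q
      using chart[of q] that by blast
    ultimately show "\<exists>U. openin (top_of_set S) U \<and> p \<in> U \<and> (\<forall>q\<in>U. \<exists>t\<in>ball (\<Phi> p) r. chart (fst t) (snd t) = q)"
      by blast
  qed
qed

lemma hol3_chart:
  assumes "\<And>t. t \<in> T \<Longrightarrow> m t \<noteq> 0 \<and> (m t)^2 \<noteq> 1 \<and> a t \<noteq> 0" "m holomorphic_on T" "a holomorphic_on T"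
  shows "hol3 (\<lambda>t. chart (m t) (a t)) T"
proof -
  have "4 - (- (m t + 1 / m t))^2 \<noteq> 0" if "t \<in> T" for t
    using trc_discr(2)[of "m t"] assms(1)[OF that] by (simp add: trc_def)
  then show ?thesis
    unfolding hol3_def chart_def fst_conv snd_conv trc_def cY_def cZ_def \<kappa>_def
    using assms by (intro conjI holomorphic_intros) auto
qed

lemma line_hol_grp_chart:
  assumes T: "\<And>t. t \<in> T \<Longrightarrow> fst t \<noteq> 0 \<and> (fst t)^2 \<noteq> 1 \<and> snd t \<noteq> 0" and \<gamma>: "\<gamma> \<in> \<Gamma>"
  shows "line_hol (\<lambda>t. fst (\<gamma> (chart (fst t) (snd t)))) T"
    "line_hol (\<lambda>t. fst (snd (\<gamma> (chart (fst t) (snd t))))) T"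
    "line_hol (\<lambda>t. snd (snd (\<gamma> (chart (fst t) (snd t))))) T"
proof -
  have "hol3 (\<gamma> \<circ> (\<lambda>s. chart (fst (cline a b s)) (snd (cline a b s)))) (cline a b -` T)" for a b
  proof (rule grp_hol3[OF \<gamma>])
    show "hol3 (\<lambda>s. chart (fst (cline a b s)) (snd (cline a b s))) (cline a b -` T)"
    proof (rule hol3_chart)
      show "(\<lambda>s. fst (cline a b s)) holomorphic_on cline a b -` T"
        "(\<lambda>s. snd (cline a b s)) holomorphic_on cline a b -` T"
        unfolding cline_def fst_conv snd_conv by (intro holomorphic_intros)+
    qed (use T in auto)
    show "(\<lambda>s. chart (fst (cline a b s)) (snd (cline a b s))) ` (cline a b -` T) \<subseteq> S"
      by (rule image_subsetI, rule chart_in_surf) (use T in auto)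
  qed
  then show "line_hol (\<lambda>t. fst (\<gamma> (chart (fst t) (snd t)))) T"
    "line_hol (\<lambda>t. fst (snd (\<gamma> (chart (fst t) (snd t))))) T"
    "line_hol (\<lambda>t. snd (snd (\<gamma> (chart (fst t) (snd t))))) T"
    unfolding line_hol_def hol3_def comp_def by blast+
qed

lemma escape_if_coordinate_escapes:
  assumes \<pi>: "continuous_on UNIV (\<pi> :: complex \<times> complex \<times> complex \<Rightarrow> complex)"
    and U: "\<And>q. q \<in> U \<Longrightarrow> \<exists>t\<in>T. P t = q"
    and esc: "\<And>M. \<forall>\<^sub>F n in sequentially. \<forall>t\<in>T. norm (\<pi> (f n (P t))) > M"
  shows "converges_to_infinity S f U"
  unfolding converges_to_infinity_def
proof (intro allI impI)
  fix V K assume VK: "compact V \<and> V \<subseteq> U \<and> compact K \<and> K \<subseteq> S"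
  then have "compact (\<pi> ` K)" by (intro compact_continuous_image continuous_on_subset[OF \<pi>]) auto
  then obtain M where M: "\<And>q. q \<in> K \<Longrightarrow> norm (\<pi> q) \<le> M"
    using compact_imp_bounded bounded_iff by (metis imageI)
  obtain N where N: "\<And>n t. n \<ge> N \<Longrightarrow> t \<in> T \<Longrightarrow> norm (\<pi> (f n (P t))) > M"
    using esc[of M] unfolding eventually_sequentially by blast
  have "f i q \<notin> K" if iq: "i \<ge> N" "q \<in> V" for i q
  proof -
    obtain t where "t \<in> T" "P t = q" using U VK iq(2) by blast
    then have "M < norm (\<pi> (f i q))" using N[OF iq(1)] by blast
    then show ?thesis using M[of "f i q"] not_less by blast
  qed
  then have "{i. f i ` V \<inter> K \<noteq> {}} \<subseteq> {..<N}" by (auto simp: not_le[symmetric])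
  then show "finite {i. f i ` V \<inter> K \<noteq> {}}" using finite_subset by blast
qed

text \<open>The dichotomy is applied to two first coordinates, that of \<open>f n\<close> and that
  of its image under the inverse of \<open>g_y\<close>; both omit the slit. If one escapes, the maps
  converge to infinity; if both are bounded, \<open>surf_bounded_if\<close> bounds the maps and
  Montel applies.\<close>

lemma slit_omitting_imp_fatou:
  assumes c: "fst c \<noteq> 0" "(fst c)^2 \<noteq> 1" "snd c \<noteq> 0" "chart (fst c) (snd c) = p"
    "\<And>r. r > 0 \<Longrightarrow> \<exists>U. openin (top_of_set S) U \<and> p \<in> U \<and> (\<forall>q\<in>U. \<exists>t\<in>ball c r. chart (fst t) (snd t) = q)"
    and W: "open W" "p \<in> W" and om: "\<And>q \<gamma>. q \<in> S \<inter> W \<Longrightarrow> \<gamma> \<in> \<Gamma> \<Longrightarrow> fst (\<gamma> q) \<notin> slit"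
  shows "p \<in> fatou A B C D"
proof -
  define P where "P t = chart (fst t) (snd t)" for t
  have fs: "(fst \<longlongrightarrow> fst c) (nhds c)" "(snd \<longlongrightarrow> snd c) (nhds c)"
    using tendsto_fst[OF filterlim_ident] tendsto_snd[OF filterlim_ident] by blast+
  have lim: "(P \<longlongrightarrow> p) (nhds c)" unfolding P_def c(4)[symmetric] by (rule tendsto_chart[OF fs c(1-3)])
  have "\<forall>\<^sub>F t in nhds c. fst t \<noteq> 0 \<and> (fst t)^2 \<noteq> 1 \<and> snd t \<noteq> 0 \<and> P t \<in> W"
    by (intro eventually_conj tendsto_imp_eventually_ne[OF fs(1) c(1)] tendsto_imp_eventually_ne[OF fs(2) c(3)]
      tendsto_imp_eventually_ne[OF tendsto_power[OF fs(1)] c(2)] topological_tendstoD[OF lim W])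
  then obtain R where R: "R > 0" "\<And>t. t \<in> ball c R \<Longrightarrow> fst t \<noteq> 0 \<and> (fst t)^2 \<noteq> 1 \<and> snd t \<noteq> 0 \<and> P t \<in> W"
    unfolding eventually_nhds_metric by (auto simp: dist_commute)
  have R3: "fst t \<noteq> 0 \<and> (fst t)^2 \<noteq> 1 \<and> snd t \<noteq> 0" if "t \<in> ball c R" for t
    using R(2)[OF that] by blast
  have PS: "P t \<in> S \<inter> W" if "t \<in> ball c R" for t
    using R(2)[OF that] chart_in_surf by (auto simp: P_def)
  note hol = line_hol_grp_chart[of "ball c R", folded P_def]
  \<comment> \<open>The dichotomy and the bound hold over radius \<open>R/2\<close>; Montel then
    gives uniform convergence over radius \<open>R/4\<close>, whose image covers
    \<open>U\<close>.\<close>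
  obtain U where U: "openin (top_of_set S) U" "p \<in> U" "\<And>q. q \<in> U \<Longrightarrow> \<exists>t\<in>ball c (R/4). P t = q"
    using c(5)[of "R/4"] R(1) unfolding P_def by auto
  then have U': "\<And>q. q \<in> U \<Longrightarrow> \<exists>t\<in>ball c (R/2). P t = q" using R(1) by force
  have "normal_family_on S \<Gamma> U"
    unfolding normal_family_on_def
  proof (intro allI impI)
    fix f :: "nat \<Rightarrow> complex \<times> complex \<times> complex \<Rightarrow> complex \<times> complex \<times> complex"
    assume "\<forall>n. f n \<in> \<Gamma>"
    then have f: "f n \<in> \<Gamma>" for n by blast
    define \<pi> where "\<pi> q = fst (s_z C (s_x A q))" for q
    have c\<pi>: "continuous_on UNIV \<pi>" "continuous_on UNIV (fst :: complex \<times> complex \<times> complex \<Rightarrow> complex)"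
      unfolding \<pi>_def s_z_def s_x_def split_beta by (auto intro!: continuous_intros)
    have X: "line_hol (\<lambda>t. fst (f n (P t))) (ball c R)" "t \<in> ball c R \<Longrightarrow> fst (f n (P t)) \<notin> slit" for n t
      using hol(1)[OF R3 f] om[OF PS f] by auto
    have X': "line_hol (\<lambda>t. \<pi> (f n (P t))) (ball c R)" "t \<in> ball c R \<Longrightarrow> \<pi> (f n (P t)) \<notin> slit" for n t
    proof -
      define h where "h = compose S (restrict (s_z C \<circ> s_x A) S) (f n)"
      have h: "h \<in> \<Gamma>" unfolding h_def by (rule grp_compose[OF grp_generators(5) f])
      have eq: "fst (h (P t)) = \<pi> (f n (P t))" if "t \<in> ball c R" for t
        using PS[OF that] grp_maps[OF f] by (simp add: h_def \<pi>_def compose_eq)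
      show "t \<in> ball c R \<Longrightarrow> \<pi> (f n (P t)) \<notin> slit" using eq om[OF PS h] by metis
      have "line_hol (\<lambda>t. fst (h (P t))) (ball c R)" by (rule hol(1)[OF R3 h])
      then show "line_hol (\<lambda>t. \<pi> (f n (P t))) (ball c R)"
        unfolding line_hol_def using eq by (smt (verit) holomorphic_transform vimage_eq)
    qed
    have R2: "0 < R / 2" "R / 2 < R" using R(1) by auto
    define dich where "dich Y \<longleftrightarrow> (\<forall>M. \<forall>\<^sub>F n in sequentially. \<forall>t\<in>ball c (R/2). norm (Y n t :: complex) > M) \<or>
       (\<exists>M. \<forall>\<^sub>F n in sequentially. \<forall>t\<in>ball c (R/2). norm (Y n t) \<le> M)" for Y :: "nat \<Rightarrow> complex \<times> complex \<Rightarrow> complex"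
    have "\<exists>k. strict_mono k \<and> dich (\<lambda>n t. fst (f (k n) (P t)))"
      unfolding dich_def by (rule slit_omitting_dichotomy[OF _ _ R2]) (rule X; assumption)+
    then obtain k1 where k1: "strict_mono k1" "dich (\<lambda>n t. fst (f (k1 n) (P t)))" by blast
    have "\<exists>k. strict_mono k \<and> dich (\<lambda>n t. \<pi> (f (k1 (k n)) (P t)))"
      unfolding dich_def
      by (rule slit_omitting_dichotomy[of "\<lambda>n t. \<pi> (f (k1 n) (P t))", OF _ _ R2]) (rule X'; assumption)+
    then obtain k2 where k2: "strict_mono k2" "dich (\<lambda>n t. \<pi> (f (k1 (k2 n)) (P t)))" by blast
    have k12: "strict_mono (k1 \<circ> k2)" using k1(1) k2(1) by (simp add: strict_mono_o)
    show "\<exists>r. strict_mono r \<and> (converges_loc_unif (f \<circ> r) U \<or> converges_to_infinity S (f \<circ> r) U)"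
    proof (cases "(\<forall>M. \<forall>\<^sub>F n in sequentially. \<forall>t\<in>ball c (R/2). norm (fst (f (k1 n) (P t))) > M) \<or>
        (\<forall>M. \<forall>\<^sub>F n in sequentially. \<forall>t\<in>ball c (R/2). norm (\<pi> (f (k1 (k2 n)) (P t))) > M)")
      case True
      then show ?thesis
      proof
        assume "\<forall>M. \<forall>\<^sub>F n in sequentially. \<forall>t\<in>ball c (R/2). norm (fst (f (k1 n) (P t))) > M"
        then have "converges_to_infinity S (f \<circ> k1) U"
          by (intro escape_if_coordinate_escapes[OF c\<pi>(2) U']) simp_all
        then show ?thesis using k1(1) by blast
      next
        assume "\<forall>M. \<forall>\<^sub>F n in sequentially. \<forall>t\<in>ball c (R/2). norm (\<pi> (f (k1 (k2 n)) (P t))) > M"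
        then have "converges_to_infinity S (f \<circ> (k1 \<circ> k2)) U"
          by (intro escape_if_coordinate_escapes[OF c\<pi>(1) U']) simp_all
        then show ?thesis using k12 by blast
      qed
    next
      case False
      then obtain M1 M2 where
        "\<forall>\<^sub>F n in sequentially. \<forall>t\<in>ball c (R/2). norm (fst (f (k1 n) (P t))) \<le> M1"
        and M2: "\<forall>\<^sub>F n in sequentially. \<forall>t\<in>ball c (R/2). norm (\<pi> (f (k1 (k2 n)) (P t))) \<le> M2"
        using k1(2) k2(2) unfolding dich_def by blast
      then have "\<forall>\<^sub>F n in sequentially. \<forall>t\<in>ball c (R/2). norm (fst (f (k1 (k2 n)) (P t))) \<le> M1"
        using eventually_subseq[OF k2(1)] by blast
      from eventually_conj[OF this M2] obtain N where N:
        "\<And>n t. n \<ge> N \<Longrightarrow> t \<in> ball c (R/2) \<Longrightarrow> norm (fst (f (k1 (k2 n)) (P t))) \<le> M1"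
        "\<And>n t. n \<ge> N \<Longrightarrow> t \<in> ball c (R/2) \<Longrightarrow> norm (\<pi> (f (k1 (k2 n)) (P t))) \<le> M2"
        unfolding eventually_sequentially by blast
      \<comment> \<open>As yz is \<open>A\<close> minus the two first coordinates, this bounds both
        x and yz.\<close>
      define M where "M = M1 + M2 + norm A"
      obtain L where L: "\<And>x y z. (x, y, z) \<in> S \<Longrightarrow> norm x \<le> M \<Longrightarrow> norm (y * z) \<le> M \<Longrightarrow> norm (x, y, z) \<le> L"
        using surf_bounded_if[of M] by fast
      define F where "F n t = f (k1 (k2 (n + N))) (P t)" for n t
      have bl: "ball c (R/2) \<subseteq> ball c R" using R2 by auto
      have bd: "norm (F n t) \<le> L" if t: "t \<in> ball c (R/2)" for n t
      proof -
        obtain x y z where xyz: "F n t = (x, y, z)" by (cases "F n t") auto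
        have "F n t \<in> S" unfolding F_def using grp_maps[OF f] PS[of t] t bl by blast
        moreover have x: "norm x \<le> M1" and p: "norm (- x - y * z + A) \<le> M2"
          using N[OF _ t, of "n + N"] xyz unfolding F_def \<pi>_def s_z_def s_x_def by auto
        moreover have "norm x \<le> M" "norm (y * z) \<le> M"
        proof -
          have 0: "0 \<le> M1" "0 \<le> M2" "0 \<le> norm A" using x p norm_ge_zero order_trans by blast+
          then show "norm x \<le> M" using x unfolding M_def by linarith
          have "norm (A - x - (- x - y * z + A)) \<le> norm A + norm x + norm (- x - y * z + A)"
            by (intro order_trans[OF norm_triangle_ineq4] add_mono order_refl norm_triangle_ineq4)
          then show "norm (y * z) \<le> M" using x p by (simp add: M_def)
        qed
        ultimately show ?thesis using L xyz by simp
      qed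
      have "\<exists>k g. strict_mono (k :: nat \<Rightarrow> nat) \<and> continuous_on (cball c (R/4)) g \<and> uniform_limit (cball c (R/4)) (F \<circ> k) g sequentially"
      proof (rule Montel_line_hol[of F c "R/2" L "R/4"])
        show "line_hol (\<lambda>t. fst (F n t)) (ball c (R/2))" "line_hol (\<lambda>t. fst (snd (F n t))) (ball c (R/2))"
          "line_hol (\<lambda>t. snd (snd (F n t))) (ball c (R/2))" for n
          unfolding F_def using line_hol_subset[OF _ bl] hol[OF R3 f] by blast+
      qed (use bd R(1) in auto)
      then obtain k3 where k3': "\<exists>g. strict_mono (k3 :: nat \<Rightarrow> nat) \<and> continuous_on (cball c (R/4)) g \<and> uniform_limit (cball c (R/4)) (F \<circ> k3) g sequentially"
        by (rule exE)
      then obtain g where "strict_mono k3 \<and> continuous_on (cball c (R/4)) g \<and> uniform_limit (cball c (R/4)) (F \<circ> k3) g sequentially"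
        by (rule exE)
      then have k3: "strict_mono k3" and ul: "uniform_limit (cball c (R/4)) (F \<circ> k3) g sequentially" by simp_all
      define r where "r n = k1 (k2 (k3 n + N))" for n
      have "strict_mono r"
        using k1(1) k2(1) k3 unfolding strict_mono_def r_def by simp
      \<comment> \<open>Convergence is known on parameters; any parameter of \<open>q\<close>
        transports it, because \<open>F n\<close> there is the value of the map at
        \<open>q\<close>.\<close>
      define \<tau> where "\<tau> q = (SOME t. t \<in> ball c (R/4) \<and> P t = q)" for q
      have \<tau>: "\<tau> q \<in> ball c (R/4)" "P (\<tau> q) = q" if "q \<in> U" for q
        using someI_ex[of "\<lambda>t. t \<in> ball c (R/4) \<and> P t = q"] U(3)[OF that] unfolding \<tau>_def by blast+
      have "uniform_limit V (f \<circ> r) (\<lambda>q. g (\<tau> q)) sequentially" if "V \<subseteq> U" for V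
      proof (rule uniform_limitI)
        fix e :: real assume "e > 0"
        from uniform_limitD[OF ul this] show "\<forall>\<^sub>F n in sequentially. \<forall>q\<in>V. dist ((f \<circ> r) n q) (g (\<tau> q)) < e"
        proof eventually_elim
          case (elim n)
          show ?case
          proof
            fix q assume "q \<in> V"
            then have q: "q \<in> U" using that by blast
            have "\<tau> q \<in> cball c (R/4)" using \<tau>(1)[OF q] by simp
            with elim have "dist ((F \<circ> k3) n (\<tau> q)) (g (\<tau> q)) < e" by blast
            then show "dist ((f \<circ> r) n q) (g (\<tau> q)) < e" using \<tau>(2)[OF q] by (simp add: F_def r_def)
          qed
        qed
      qed
      then have "converges_loc_unif (f \<circ> r) U" unfolding converges_loc_unif_def by blast
      then show ?thesis using \<open>strict_mono r\<close> by blast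
    qed
  qed
  then show ?thesis using U(1,2) openin_imp_subset unfolding fatou_def by blast
qed

lemma julia_reaches_slit:
  assumes p: "p \<in> julia A B C D" and W: "open W" "p \<in> W"
  shows "\<exists>q\<in>S \<inter> W. \<exists>q'. q \<asymp> q' \<and> fst q' \<in> slit"
proof (rule ccontr)
  assume "\<not> ?thesis"
  then have no: "\<And>q q'. q \<in> W \<Longrightarrow> q \<asymp> q' \<Longrightarrow> fst q' \<notin> slit" using orbit_equiv_surf(1) by blast
  have pS: "p \<in> S" using p by (simp add: julia_def)
  have px: "fst p \<notin> slit" using no[OF W(2) orbit_equiv_refl[OF pS]] .
  define j where "j = joukowski_inv (fst p)"
  show False
  proof (cases "coordA j p \<noteq> 0 \<or> coordA (1/j) p \<noteq> 0")
    case True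
    show False
    proof (rule local_chart[OF pS px True[unfolded j_def]])
      fix c assume c: "fst c \<noteq> 0" "(fst c)^2 \<noteq> 1" "snd c \<noteq> 0" "chart (fst c) (snd c) = p"
        "\<And>r. r > 0 \<Longrightarrow> \<exists>U. openin (top_of_set S) U \<and> p \<in> U \<and> (\<forall>q\<in>U. \<exists>t\<in>ball c r. chart (fst t) (snd t) = q)"
      have "p \<in> fatou A B C D"
        by (rule slit_omitting_imp_fatou[OF c W]) (use no orbit_equivI in blast)+
      then show False using p by (simp add: julia_def)
    qed
  next
    case False
    \<comment> \<open>The expanding eigenline belongs to the root of modulus above 1, hence the
      reciprocal of \<open>j\<close>.\<close>
    have "norm (1/j) > 1" "fst p = trc (1/j)"
      using joukowski_inv[OF px] by (simp_all add: j_def norm_divide trc_def add.commute)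
    then show False
      using degenerate_center_reaches_slit[of "1/j" p W] pS False W no by auto
  qed
qed

section \<open>Transitivity on the Julia set\<close>

lemma open_saturation:
  assumes "open U"
  shows "\<exists>V. open V \<and> (\<forall>p\<in>S. p \<in> V \<longleftrightarrow> (\<exists>q\<in>U. p \<asymp> q))"
proof -
  have "openin (top_of_set S) (\<Union>\<gamma>\<in>\<Gamma>. S \<inter> \<gamma> -` U)"
    using continuous_openin_preimage_gen[OF grp_continuous assms] by blast
  then obtain V where V: "open V" "(\<Union>\<gamma>\<in>\<Gamma>. S \<inter> \<gamma> -` U) = S \<inter> V" unfolding openin_open by blast
  have "p \<in> V \<longleftrightarrow> (\<exists>q\<in>U. p \<asymp> q)" if p: "p \<in> S" for p
  proof -
    have "p \<in> V \<longleftrightarrow> p \<in> (\<Union>\<gamma>\<in>\<Gamma>. S \<inter> \<gamma> -` U)" unfolding V(2) using p by blast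
    also have "\<dots> \<longleftrightarrow> (\<exists>\<gamma>\<in>\<Gamma>. \<gamma> p \<in> U)" using p by simp
    also have "\<dots> \<longleftrightarrow> (\<exists>q\<in>U. p \<asymp> q)" using p by (simp only: orbit_equiv_def) blast
    finally show ?thesis .
  qed
  with V(1) show ?thesis by blast
qed

text \<open>The generic fibre found near the slit need not be the prescribed one.
  \<open>common_orbit_point\<close> with both sets equal to the saturation \<open>V\<close>
  transports a point to the fibre over \<open>trc \<mu>\<close>, and it stays in \<open>V\<close>
  because \<open>V\<close> is saturated.\<close>

lemma saturation_meets_generic_fibre:
  assumes \<mu>: "generic \<mu>" and U: "open U" "U \<inter> julia A B C D \<noteq> {}"
  shows "\<exists>V v. open V \<and> v \<in> V \<and> v \<in> S \<and> fst v = trc \<mu> \<and> (\<forall>p\<in>S. p \<in> V \<longrightarrow> (\<exists>q\<in>U. p \<asymp> q))"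
proof -
  obtain V where V: "open V" "\<And>p. p \<in> S \<Longrightarrow> p \<in> V \<longleftrightarrow> (\<exists>q\<in>U. p \<asymp> q)"
    using open_saturation[OF U(1)] by blast
  obtain p where p: "p \<in> U" "p \<in> julia A B C D" using U(2) by blast
  obtain q q' where q: "q \<in> U" "q \<asymp> q'" "fst q' \<in> slit"
    using julia_reaches_slit[OF p(2) U(1) p(1)] by blast
  have q'S: "q' \<in> S" using orbit_equiv_surf(2)[OF q(2)] .
  then have "q' \<in> V" using V(2) q orbit_equiv_sym by blast
  then obtain w \<mu>1 where w: "w \<in> S" "w \<in> V" "generic \<mu>1" "fst w = trc \<mu>1" "trc \<mu>1 \<notin> {A - trc \<mu>}"
    using slit_generic_near[OF q'S q(3) V(1), of "{A - trc \<mu>}"] by blast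
  then have "A - trc \<mu>1 - trc \<mu> \<noteq> 0" by (auto simp: algebra_simps)
  from common_orbit_point[OF w(3) this V(1) w(2,1,4) V(1) w(2,1,4)]
  obtain v v' where v: "v \<in> S" "fst v = trc \<mu>" "v' \<in> V" "v \<asymp> v'" by blast
  then have "v \<in> V" using V(2) orbit_equiv_surf(2) orbit_equiv_trans by blast
  then show ?thesis using V v(1,2) by blast
qed

theorem dense_orbit: "\<exists>p \<in> julia A B C D. closure (grp_orbit A B C D p) = julia A B C D"
proof -
  \<comment> \<open>Source and target fibre will coincide, so the product yz to be prescribed is
    \<open>A - 2 * trc \<mu>\<close>; excluding \<open>A / 2\<close> makes it nonzero.\<close>
  obtain \<mu> r where \<mu>: "generic \<mu>" "trc \<mu> = of_real r" "trc \<mu> \<notin> {A / 2}"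
    using generic_dense[of "-2" 2 "{A / 2}"] by auto
  have s: "A - trc \<mu> - trc \<mu> \<noteq> 0" using \<mu>(3) by (auto simp: field_simps)
  show ?thesis
  proof (rule dense_orbit_if_transitive)
    have "chart \<mu> 1 \<in> S" using chart_in_surf generic_simps[OF \<mu>(1)] by simp
    then show "julia A B C D \<noteq> {}"
      using generic_fibre_subset_julia[OF \<mu>(1), of "chart \<mu> 1"] unfolding chart_def by auto
    fix U V :: "(complex \<times> complex \<times> complex) set"
    assume U: "open U" "U \<inter> julia A B C D \<noteq> {}" and V: "open V" "V \<inter> julia A B C D \<noteq> {}"
    obtain U' u where u: "open U'" "u \<in> U'" "u \<in> S" "fst u = trc \<mu>" "\<forall>p\<in>S. p \<in> U' \<longrightarrow> (\<exists>q\<in>U. p \<asymp> q)"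
      using saturation_meets_generic_fibre[OF \<mu>(1) U] by blast
    obtain V' v where v: "open V'" "v \<in> V'" "v \<in> S" "fst v = trc \<mu>" "\<forall>p\<in>S. p \<in> V' \<longrightarrow> (\<exists>q\<in>V. p \<asymp> q)"
      using saturation_meets_generic_fibre[OF \<mu>(1) V] by blast
    \<comment> \<open>The target is again the generic fibre, so \<open>p\<close>, and with it
      \<open>q1\<close> and \<open>q2\<close>, lies in the Julia set.\<close>
    from common_orbit_point[OF \<mu>(1) s u(1-4) v(1-4)] obtain p u' v' where
      p: "p \<in> S" "fst p = trc \<mu>" "u' \<in> U'" "p \<asymp> u'" "v' \<in> V'" "p \<asymp> v'" by blast
    obtain q1 where q1: "q1 \<in> U" "p \<asymp> q1" using u(5) p orbit_equiv_surf(2) orbit_equiv_trans by blast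
    obtain q2 where q2: "q2 \<in> V" "p \<asymp> q2" using v(5) p orbit_equiv_surf(2) orbit_equiv_trans by blast
    have "q1 \<in> julia A B C D"
      using julia_invariant[OF q1(2)] generic_fibre_subset_julia[OF \<mu>(1) p(1,2)] by blast
    moreover have "q1 \<asymp> q2" using q1(2) q2(2) orbit_equiv_sym orbit_equiv_trans by blast
    ultimately show "\<exists>p q. p \<in> U \<inter> julia A B C D \<and> q \<in> V \<and> p \<asymp> q" using q1 q2 by blast
  qed
qed

end

theorem theoremA:
  fixes A B C D :: complex
  shows "\<exists>p \<in> julia A B C D. closure (grp_orbit A B C D p) = julia A B C D"
  by (rule cubic_surface.dense_orbit)

end
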